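(* Let $\mathcal{G}=(\mathcal{V},\mathcal{E})$ be a tree on $\mathcal{V}=\{0,\dots,n\}$ with line weights $B_{ik}=B_{ki}>0$, let $p,q\in\mathbb{R}^n$, and let $w_1,\dots,w_n>0$ be arbitrary weights. With the power flow equations (PF), the three solution approaches (relaxation, energy function, fixed point), and the meaning of "succeeds" as defined in the context, the following two statements are equivalent: (i) the power flow equations (PF) have a solution; (ii) the relaxation approach, the energy function approach, and the fixed-point approach all succeed. If either of these equivalent statements is true, then all three approaches compute the same power flow solution.
   Context: Network. $\mathcal{G}=(\mathcal{V},\mathcal{E})$ is a tree with $\mathcal{V}=\{0,1,\dots,n\}$, rooted at bus $0$, edges oriented away from $0$; $\mathcal{N}(i)$ is the set of neighbours of $i$; $[n]=\{1,\dots,n\}$. Each edge has a weight $B_{ik}=B_{ki}>0$, and $\mathbf{B}_i=\sum_{k\in\mathcal{N}(i)}B_{ik}$ (the sum includes $k=0$ when $0$ is a neighbour of $i$). Bus $0$ has fixed squared voltage magnitude $v_0=1$ and phase $\theta_0=0$. All voltage vectors $v=(v_1,\dots,v_n)$ are required to be strictly positive. Vector inequalities are componentwise. $L_{\rm red}\in\mathbb{R}^{n\times n}$ is the reduced Laplacian: $(L_{\rm red})_{ii}=\mathbf{B}_i$, $(L_{\rm red})_{ik}=-B_{ik}$ if $k\in\mathcal{N}(i)$, and $0$ otherwise, for $i\ne k\in[n]$. $\mathbf{1}_n$ is the all-ones vector. Flows. Given $p\in\mathbb{R}^n$, $s=s(p)$ denotes the unique solution, with $s_{ki}=-s_{ik}$,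 of the linear system $\sum_{k\in\mathcal{N}(i)}B_{ik}s_{ik}=p_i$, $i\in[n]$. Power flow equations (PF). Unknowns $v\in\mathbb{R}^n_{>0}$ and $c=(c_{ik})_{(i,k)\in\mathcal{E}}$ real, $c_{ik}=c_{ki}$: $$\mathbf{B}_iv_i-\sum_{k\in\mathcal{N}(i)}B_{ik}c_{ik}=q_i\ \ \forall i\in[n],\qquad s_{ik}(p)^2+c_{ik}^2=v_iv_k\ \ \forall (i,k)\in\mathcal{E}.$$ Convention: any expression $\sqrt{v_iv_k-s_{ik}^2}$ appearing in a constraint or equation implicitly requires $v_iv_k\ge s_{ik}^2$. Relaxation approach. Consider $$\text{maximize}_{v\in\mathbb{R}^n_{>0}}\ \sum_{i=1}^n w_i\log v_i\quad\text{subject to}\quad \mathbf{B}_iv_i-\sum_{k\in\mathcal{N}(i)}B_{ik}\sqrt{v_iv_k-s_{ik}(p)^2}\le q_i\ \ \forall i\in[n].$$ It succeeds if this problem is feasible and its optimal solution $v^\star$ satisfies all the constraints with equality; the computed solution is $v^\star$ with $s^\star_{ik}=s_{ik}(p)$, $c^\star_{ik}=\sqrt{v^\star_iv^\star_k-(s^\star_{ik})^2}$. Otherwise it fails. Energy function approach. For $v\in\mathbb{R}^n_{>0}$, $\theta\in\mathbb{R}^n$ (with $v_0=1,\theta_0=0$) let $$E(v,\theta)=\sum_{(i,k)\in\mathcal{E}}B_{ik}\bigl(v_i+v_k-2\sqrt{v_iv_k}\cos(\theta_i-\theta_k)\bigr)-2\sum_{i=1}^np_i\theta_i-\sum_{i=1}^nq_i\log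 v_i .$$ Stationarity of $E$ with respect to $(\log v,\theta)$ is equivalent to $\sum_{k\in\mathcal{N}(i)}B_{ik}\sqrt{v_iv_k}\sin(\theta_i-\theta_k)=p_i$ and $\mathbf{B}_iv_i-\sum_{k\in\mathcal{N}(i)}B_{ik}\sqrt{v_iv_k}\cos(\theta_i-\theta_k)=q_i$ for all $i\in[n]$. Consider the problem of minimizing $E(v,\theta)$ subject to $$\sum_{i=1}^n2\mathbf{B}_iv_i\,e_ie_i^{T}-\sum_{(i,k)\in\mathcal{E}}\frac{B_{ik}v_iv_k}{c_{ik}}(e_i+e_k)(e_i+e_k)^{T}\succeq0,\qquad c_{ik}:=\sqrt{v_iv_k}\cos(\theta_i-\theta_k)>0\ \ \forall(i,k)\in\mathcal{E},$$ where $e_1,\dots,e_n$ are the standard basis vectors of $\mathbb{R}^n$ and $e_0:=0$. The approach succeeds if there exists an optimizer $(v^\star,\theta^\star)$ of this problem at which $\partial E/\partial\log v=0$ and $\partial E/\partial\theta=0$; the computed solution is $v^\star$ with $s^\star_{ik}=\sqrt{v_i^\star v_k^\star}\sin(\theta^\star_i-\theta^\star_k)$, $c^\star_{ik}=\sqrt{v_i^\star v_k^\star}\cos(\theta^\star_i-\theta^\star_k)$. Otherwise it fails. Fixed-point approach. Let $$g_i(v)=\frac{q_i}{\mathbf{B}_i}+\sum_{k\in\mathcal{N}(i)}\frac{B_{ik}}{\mathbf{B}_i}\sqrt{v_iv_k-s_{ik}(p)^2},\quad i\in[n],$$ and iterate $v^{(j+1)}=g(v^{(j)})$ from $v^{(0)}=v^{\max}:=\mathbf{1}_n+2L_{\rm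 red}^{-1}q$. It succeeds if the iteration (is well defined and) converges to a point $v^\star\in\mathbb{R}^n_{>0}$ with $g(v^\star)=v^\star$; the computed solution is $v^\star$ with $s^\star_{ik}=s_{ik}(p)$, $c^\star_{ik}=\sqrt{v_i^\star v_k^\star-(s^\star_{ik})^2}$. Otherwise it fails.
   Formalization: In the energy function problem, phase differences across edges are additionally required to satisfy |θ_i − θ_k| ≤ π; without this, E is unbounded below on the feasible set whenever p ≠ 0 (shift θ by 2π multiples on a subtree), so no optimizer exists even when (PF) is solvable. *)

theory Defs
  imports "HOL-Analysis.Analysis"
begin

(* The n non-root buses are the elements of a finite type 'n; the root bus 0 is None and bus i is
   Some i.  An edge set is a set of ordered pairs, (i,k) being an edge oriented from i to k. *)

type_synonym 'n edges = "('n option \<times> 'n option) set"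

definition adj :: "('a \<times> 'a) set \<Rightarrow> 'a \<Rightarrow> 'a \<Rightarrow> bool" where
  "adj E u w \<longleftrightarrow> (u, w) \<in> E \<or> (w, u) \<in> E"

definition nbrs :: "('a \<times> 'a) set \<Rightarrow> 'a \<Rightarrow> 'a set" where
  "nbrs E u = {w. adj E u w}"

definition undirected_cycle :: "('a \<times> 'a) set \<Rightarrow> 'a list \<Rightarrow> bool" where
  "undirected_cycle E xs \<longleftrightarrow>
     3 \<le> length xs \<and> distinct xs \<and> successively (adj E) xs \<and> adj E (last xs) (hd xs)"

(* The undirected graph underlying E is a tree on the whole type.  The first conjunct says that
   every undirected edge carries exactly one orientation and excludes loops. *)
definition is_tree :: "('a \<times> 'a) set \<Rightarrow> bool" where
  "is_tree E \<longleftrightarrow>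
     (\<forall>u w. (u, w) \<in> E \<longrightarrow> (w, u) \<notin> E) \<and>
     (\<forall>u w. (u, w) \<in> (E \<union> E\<inverse>)\<^sup>*) \<and>
     (\<nexists>xs. undirected_cycle E xs)"

(* In a tree, all edges point away from r iff every vertex can be reached from r along them. *)
definition oriented_away_from :: "'a \<Rightarrow> ('a \<times> 'a) set \<Rightarrow> bool" where
  "oriented_away_from r E \<longleftrightarrow> (\<forall>u. (r, u) \<in> E\<^sup>*)"

definition edge_weights :: "('a \<times> 'a) set \<Rightarrow> ('a \<Rightarrow> 'a \<Rightarrow> real) \<Rightarrow> bool" where
  "edge_weights E B \<longleftrightarrow> (\<forall>i k. adj E i k \<longrightarrow> B i k = B k i \<and> 0 < B i k)"

definition Bsum :: "('a \<times> 'a) set \<Rightarrow> ('a \<Rightarrow> 'a \<Rightarrow> real) \<Rightarrow> 'a \<Rightarrow> real" where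
  "Bsum E B i = (\<Sum>k\<in>nbrs E i. B i k)"

(* Squared voltage magnitudes and phases at all buses, with v_0 = 1 and theta_0 = 0. *)
definition volt :: "real ^ 'n \<Rightarrow> 'n option \<Rightarrow> real" where
  "volt v b = (case b of None \<Rightarrow> 1 | Some i \<Rightarrow> v $ i)"

definition phase :: "real ^ 'n \<Rightarrow> 'n option \<Rightarrow> real" where
  "phase \<theta> b = (case b of None \<Rightarrow> 0 | Some i \<Rightarrow> \<theta> $ i)"

definition positive :: "real ^ 'n \<Rightarrow> bool" where
  "positive v \<longleftrightarrow> (\<forall>i. 0 < v $ i)"

(* Edge quantities s, c are functions of two buses that are set to 0 off the edges, so that
   equality of functions is equality on all edges. *)
definition on_edges ::
    "('a \<times> 'a) set \<Rightarrow> ('a \<Rightarrow> 'a \<Rightarrow> real) \<Rightarrow> 'a \<Rightarrow> 'a \<Rightarrow> real" where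
  "on_edges E f = (\<lambda>i k. if adj E i k then f i k else 0)"

definition flow ::
    "'n::finite edges \<Rightarrow> ('n option \<Rightarrow> 'n option \<Rightarrow> real) \<Rightarrow> real ^ 'n
     \<Rightarrow> 'n option \<Rightarrow> 'n option \<Rightarrow> real" where
  "flow E B p = (THE s.
     (\<forall>i k. s k i = - s i k) \<and>
     (\<forall>i k. \<not> adj E i k \<longrightarrow> s i k = 0) \<and>
     (\<forall>i. (\<Sum>k\<in>nbrs E (Some i). B (Some i) k * s (Some i) k) = p $ i))"

type_synonym 'n solution =
  "(real ^ 'n) \<times> ('n option \<Rightarrow> 'n option \<Rightarrow> real) \<times> ('n option \<Rightarrow> 'n option \<Rightarrow> real)"

definition power_flow_solution ::
    "'n::finite edges \<Rightarrow> ('n option \<Rightarrow> 'n option \<Rightarrow> real) \<Rightarrow> real ^ 'n \<Rightarrow> real ^ 'n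
     \<Rightarrow> 'n solution \<Rightarrow> bool" where
  "power_flow_solution E B p q = (\<lambda>(v, s, c).
     positive v \<and>
     s = flow E B p \<and>
     (\<forall>i k. c i k = c k i) \<and>
     (\<forall>i k. \<not> adj E i k \<longrightarrow> c i k = 0) \<and>
     (\<forall>i. Bsum E B (Some i) * v $ i
            - (\<Sum>k\<in>nbrs E (Some i). B (Some i) k * c (Some i) k) = q $ i) \<and>
     (\<forall>(i, k)\<in>E. (s i k)\<^sup>2 + (c i k)\<^sup>2 = volt v i * volt v k))"

(* sqrt is a total function on the reals: sqrt_defined states the implicit requirement
   v_i v_k \<ge> s_ik^2 under which root_term is meaningful. *)
definition root_term ::
    "'n::finite edges \<Rightarrow> ('n option \<Rightarrow> 'n option \<Rightarrow> real) \<Rightarrow> real ^ 'n \<Rightarrow> real ^ 'n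
     \<Rightarrow> 'n option \<Rightarrow> 'n option \<Rightarrow> real" where
  "root_term E B p v i k = sqrt (volt v i * volt v k - (flow E B p i k)\<^sup>2)"

definition sqrt_defined ::
    "'n::finite edges \<Rightarrow> ('n option \<Rightarrow> 'n option \<Rightarrow> real) \<Rightarrow> real ^ 'n \<Rightarrow> real ^ 'n
     \<Rightarrow> bool" where
  "sqrt_defined E B p v \<longleftrightarrow> (\<forall>(i, k)\<in>E. (flow E B p i k)\<^sup>2 \<le> volt v i * volt v k)"


definition relaxation_lhs ::
    "'n::finite edges \<Rightarrow> ('n option \<Rightarrow> 'n option \<Rightarrow> real) \<Rightarrow> real ^ 'n \<Rightarrow> real ^ 'n
     \<Rightarrow> 'n \<Rightarrow> real" where
  "relaxation_lhs E B p v i =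
     Bsum E B (Some i) * v $ i
     - (\<Sum>k\<in>nbrs E (Some i). B (Some i) k * root_term E B p v (Some i) k)"

definition relaxation_feasible ::
    "'n::finite edges \<Rightarrow> ('n option \<Rightarrow> 'n option \<Rightarrow> real) \<Rightarrow> real ^ 'n \<Rightarrow> real ^ 'n
     \<Rightarrow> real ^ 'n \<Rightarrow> bool" where
  "relaxation_feasible E B p q v \<longleftrightarrow>
     positive v \<and> sqrt_defined E B p v \<and> (\<forall>i. relaxation_lhs E B p v i \<le> q $ i)"

definition relaxation_objective :: "real ^ 'n \<Rightarrow> real ^ 'n \<Rightarrow> real" where
  "relaxation_objective w v = (\<Sum>i\<in>UNIV. w $ i * ln (v $ i))"

definition relaxation_optimal ::
    "'n::finite edges \<Rightarrow> ('n option \<Rightarrow> 'n option \<Rightarrow> real) \<Rightarrow> real ^ 'n \<Rightarrow> real ^ 'n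
     \<Rightarrow> real ^ 'n \<Rightarrow> real ^ 'n \<Rightarrow> bool" where
  "relaxation_optimal E B p q w v \<longleftrightarrow>
     relaxation_feasible E B p q v \<and>
     (\<forall>u. relaxation_feasible E B p q u \<longrightarrow>
            relaxation_objective w u \<le> relaxation_objective w v)"

definition relaxation_computes ::
    "'n::finite edges \<Rightarrow> ('n option \<Rightarrow> 'n option \<Rightarrow> real) \<Rightarrow> real ^ 'n \<Rightarrow> real ^ 'n
     \<Rightarrow> real ^ 'n \<Rightarrow> 'n solution \<Rightarrow> bool" where
  "relaxation_computes E B p q w = (\<lambda>(v, s, c).
     relaxation_optimal E B p q w v \<and>
     (\<forall>u. relaxation_optimal E B p q w u \<longrightarrow> u = v) \<and>
     (\<forall>i. relaxation_lhs E B p v i = q $ i) \<and>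
     s = flow E B p \<and>
     c = on_edges E (root_term E B p v))"

definition relaxation_succeeds ::
    "'n::finite edges \<Rightarrow> ('n option \<Rightarrow> 'n option \<Rightarrow> real) \<Rightarrow> real ^ 'n \<Rightarrow> real ^ 'n
     \<Rightarrow> real ^ 'n \<Rightarrow> bool" where
  "relaxation_succeeds E B p q w \<longleftrightarrow> (\<exists>x. relaxation_computes E B p q w x)"


definition energy ::
    "'n::finite edges \<Rightarrow> ('n option \<Rightarrow> 'n option \<Rightarrow> real) \<Rightarrow> real ^ 'n \<Rightarrow> real ^ 'n
     \<Rightarrow> real ^ 'n \<Rightarrow> real ^ 'n \<Rightarrow> real" where
  "energy E B p q v \<theta> =
     (\<Sum>(i, k)\<in>E. B i k * (volt v i + volt v k
         - 2 * sqrt (volt v i * volt v k) * cos (phase \<theta> i - phase \<theta> k)))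
     - 2 * (\<Sum>i\<in>UNIV. p $ i * \<theta> $ i)
     - (\<Sum>i\<in>UNIV. q $ i * ln (v $ i))"

definition cos_term :: "real ^ 'n \<Rightarrow> real ^ 'n \<Rightarrow> 'n option \<Rightarrow> 'n option \<Rightarrow> real" where
  "cos_term v \<theta> i k = sqrt (volt v i * volt v k) * cos (phase \<theta> i - phase \<theta> k)"

definition sin_term :: "real ^ 'n \<Rightarrow> real ^ 'n \<Rightarrow> 'n option \<Rightarrow> 'n option \<Rightarrow> real" where
  "sin_term v \<theta> i k = sqrt (volt v i * volt v k) * sin (phase \<theta> i - phase \<theta> k)"

definition unit_vec :: "'n::finite option \<Rightarrow> real ^ 'n" where
  "unit_vec b = (case b of None \<Rightarrow> 0 | Some i \<Rightarrow> axis i 1)"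

definition outer :: "real ^ 'n \<Rightarrow> real ^ 'n ^ 'n" where
  "outer x = (\<chi> i j. x $ i * x $ j)"

definition pos_semidef :: "real ^ 'n::finite ^ 'n \<Rightarrow> bool" where
  "pos_semidef A \<longleftrightarrow> transpose A = A \<and> (\<forall>x. 0 \<le> x \<bullet> (A *v x))"

definition energy_matrix ::
    "'n::finite edges \<Rightarrow> ('n option \<Rightarrow> 'n option \<Rightarrow> real) \<Rightarrow> real ^ 'n \<Rightarrow> real ^ 'n
     \<Rightarrow> real ^ 'n ^ 'n" where
  "energy_matrix E B v \<theta> =
     (\<Sum>i\<in>UNIV. (2 * Bsum E B (Some i) * v $ i) *\<^sub>R outer (unit_vec (Some i)))
     - (\<Sum>(i, k)\<in>E. (B i k * volt v i * volt v k / cos_term v \<theta> i k)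
                      *\<^sub>R outer (unit_vec i + unit_vec k))"

(* Phase differences across edges are angles represented in [-pi, pi]; with cos > 0 this says
   that they lie in the open interval (-pi/2, pi/2).  On a tree every phase vector can be
   brought into this form by adding multiples of 2 pi to its components, which changes neither
   the constraints nor the stationarity equations, but does change the term 2 * sum p_i theta_i
   of the energy: without the normalization the energy would be unbounded below on a nonempty
   feasible set as soon as p is nonzero, so that no optimizer would exist. *)
definition energy_feasible ::
    "'n::finite edges \<Rightarrow> ('n option \<Rightarrow> 'n option \<Rightarrow> real) \<Rightarrow> real ^ 'n \<Rightarrow> real ^ 'n
     \<Rightarrow> bool" where
  "energy_feasible E B v \<theta> \<longleftrightarrow>
     positive v \<and>
     (\<forall>(i, k)\<in>E. \<bar>phase \<theta> i - phase \<theta> k\<bar> \<le> pi) \<and>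
     (\<forall>(i, k)\<in>E. 0 < cos_term v \<theta> i k) \<and>
     pos_semidef (energy_matrix E B v \<theta>)"

definition energy_optimal ::
    "'n::finite edges \<Rightarrow> ('n option \<Rightarrow> 'n option \<Rightarrow> real) \<Rightarrow> real ^ 'n \<Rightarrow> real ^ 'n
     \<Rightarrow> real ^ 'n \<Rightarrow> real ^ 'n \<Rightarrow> bool" where
  "energy_optimal E B p q v \<theta> \<longleftrightarrow>
     energy_feasible E B v \<theta> \<and>
     (\<forall>u \<phi>. energy_feasible E B u \<phi> \<longrightarrow> energy E B p q v \<theta> \<le> energy E B p q u \<phi>)"

definition upd :: "real ^ 'n \<Rightarrow> 'n \<Rightarrow> real \<Rightarrow> real ^ 'n" where
  "upd x i t = (\<chi> j. if j = i then t else x $ j)"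

(* All partial derivatives of the energy with respect to log v_i and theta_i vanish. *)
definition energy_stationary ::
    "'n::finite edges \<Rightarrow> ('n option \<Rightarrow> 'n option \<Rightarrow> real) \<Rightarrow> real ^ 'n \<Rightarrow> real ^ 'n
     \<Rightarrow> real ^ 'n \<Rightarrow> real ^ 'n \<Rightarrow> bool" where
  "energy_stationary E B p q v \<theta> \<longleftrightarrow>
     (\<forall>i. ((\<lambda>t. energy E B p q (upd v i (exp t)) \<theta>) has_real_derivative 0) (at (ln (v $ i)))) \<and>
     (\<forall>i. ((\<lambda>t. energy E B p q v (upd \<theta> i t)) has_real_derivative 0) (at (\<theta> $ i)))"

definition energy_computes ::
    "'n::finite edges \<Rightarrow> ('n option \<Rightarrow> 'n option \<Rightarrow> real) \<Rightarrow> real ^ 'n \<Rightarrow> real ^ 'n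
     \<Rightarrow> 'n solution \<Rightarrow> bool" where
  "energy_computes E B p q = (\<lambda>(v, s, c). \<exists>\<theta>.
     energy_optimal E B p q v \<theta> \<and>
     energy_stationary E B p q v \<theta> \<and>
     s = on_edges E (sin_term v \<theta>) \<and>
     c = on_edges E (cos_term v \<theta>))"

definition energy_succeeds ::
    "'n::finite edges \<Rightarrow> ('n option \<Rightarrow> 'n option \<Rightarrow> real) \<Rightarrow> real ^ 'n \<Rightarrow> real ^ 'n
     \<Rightarrow> bool" where
  "energy_succeeds E B p q \<longleftrightarrow> (\<exists>x. energy_computes E B p q x)"


definition reduced_laplacian ::
    "'n::finite edges \<Rightarrow> ('n option \<Rightarrow> 'n option \<Rightarrow> real) \<Rightarrow> real ^ 'n ^ 'n" where
  "reduced_laplacian E B = (\<chi> i k.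
     if i = k then Bsum E B (Some i)
     else if Some k \<in> nbrs E (Some i) then - B (Some i) (Some k)
     else 0)"

definition v_max ::
    "'n::finite edges \<Rightarrow> ('n option \<Rightarrow> 'n option \<Rightarrow> real) \<Rightarrow> real ^ 'n \<Rightarrow> real ^ 'n" where
  "v_max E B q = (\<chi> i. 1) + 2 *\<^sub>R (matrix_inv (reduced_laplacian E B) *v q)"

definition fp_map ::
    "'n::finite edges \<Rightarrow> ('n option \<Rightarrow> 'n option \<Rightarrow> real) \<Rightarrow> real ^ 'n \<Rightarrow> real ^ 'n
     \<Rightarrow> real ^ 'n \<Rightarrow> real ^ 'n" where
  "fp_map E B p q v = (\<chi> i.
     q $ i / Bsum E B (Some i)
     + (\<Sum>k\<in>nbrs E (Some i).
          B (Some i) k / Bsum E B (Some i) * root_term E B p v (Some i) k))"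

definition fp_iterate ::
    "'n::finite edges \<Rightarrow> ('n option \<Rightarrow> 'n option \<Rightarrow> real) \<Rightarrow> real ^ 'n \<Rightarrow> real ^ 'n
     \<Rightarrow> nat \<Rightarrow> real ^ 'n" where
  "fp_iterate E B p q j = (fp_map E B p q ^^ j) (v_max E B q)"

(* The iteration is well defined if all iterates lie in the domain of g, i.e. are strictly
   positive voltage vectors at which all square roots are defined. *)
definition fixed_point_computes ::
    "'n::finite edges \<Rightarrow> ('n option \<Rightarrow> 'n option \<Rightarrow> real) \<Rightarrow> real ^ 'n \<Rightarrow> real ^ 'n
     \<Rightarrow> 'n solution \<Rightarrow> bool" where
  "fixed_point_computes E B p q = (\<lambda>(v, s, c).
     (\<forall>j. positive (fp_iterate E B p q j) \<and> sqrt_defined E B p (fp_iterate E B p q j)) \<and>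
     fp_iterate E B p q \<longlonglongrightarrow> v \<and>
     positive v \<and> sqrt_defined E B p v \<and> fp_map E B p q v = v \<and>
     s = flow E B p \<and>
     c = on_edges E (root_term E B p v))"

definition fixed_point_succeeds ::
    "'n::finite edges \<Rightarrow> ('n option \<Rightarrow> 'n option \<Rightarrow> real) \<Rightarrow> real ^ 'n \<Rightarrow> real ^ 'n
     \<Rightarrow> bool" where
  "fixed_point_succeeds E B p q \<longleftrightarrow> (\<exists>x. fixed_point_computes E B p q x)"

end

theory Submission
  imports Defs
begin

text \<open>The map \<open>v \<mapsto> sqrt (v\<^sub>i v\<^sub>k - s\<^sub>i\<^sub>k\<^sup>2)\<close> is monotone and concave.  Monotonicity makes the fixed-point
  iteration decrease from the upper bound \<open>v\<^sup>m\<^sup>a\<^sup>x\<close> of the feasible set of the relaxation to a greatest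
  feasible point, which is the unique maximizer of every objective with positive weights.  At that
  point no \<open>c\<^sub>i\<^sub>k\<close> vanishes and the energy matrix is positive semidefinite, since otherwise \<open>v\<close> could
  be increased further.

  In the coordinates \<open>(log v, \<theta>)\<close> the energy matrix is a Schur complement of the Hessian of the
  energy, and the feasible set of the energy problem is convex because \<open>exp a / cos x\<close> is convex.
  Hence the energy is convex on that set and feasible stationary points are optimizers.  Strict
  concavity along an edge with one endpoint fixed, propagated from the root, shows that every such
  point has the voltages of the greatest feasible point.\<close>

section \<open>Trees\<close>

text \<open>On a tree the flows depend on \<open>p\<close> alone, and any prescribed angle
  differences on the edges come from a phase vector, so all three approaches reduce to equations for
  \<open>v\<close>. A solution of (PF) may have negative \<open>c\<close>; its \<open>v\<close> then
  satisfies the relaxed constraints only as inequalities. Equality is recovered at the greatest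
  feasible point, which is why that point, and not the given solution, is the one computed. The
  start \<open>v_max\<close> solves exactly the equations in which every square root is replaced by
  the arithmetic mean that dominates it. On the energy side the obstacle is that the energy is not
  convex in \<open>(log v, \<theta>)\<close> as a whole and that the semidefinite constraint is not
  evidently convex. Where all \<open>c\<close> are positive, the off-diagonal entries of the energy
  matrix are nonpositive, so negativity of its quadratic form can be tested on nonnegative vectors.
  This serves both the eigenvector argument at the greatest feasible point and the convexity of the
  feasible set.\<close>

lemma adj_sym: "adj E u w \<longleftrightarrow> adj E w u"
  by (auto simp: adj_def)

lemma rtrancl_imp_distinct_path:
  assumes "(a, b) \<in> {(x, y). P x y}\<^sup>*"
  shows "\<exists>xs. xs \<noteq> [] \<and> hd xs = a \<and> last xs = b \<and> distinct xs \<and> successively P xs"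
  using assms
proof (induction rule: converse_rtrancl_induct)
  case base
  show ?case by (rule exI[of _ "[b]"]) simp
next
  case (step a a')
  then obtain xs where xs: "xs \<noteq> []" "hd xs = a'" "last xs = b" "distinct xs" "successively P xs"
    by blast
  show ?case
  proof (cases "a \<in> set xs")
    \<comment> \<open>Loop erasure: the walk returns to \<open>a\<close>, so only its part from
      \<open>a\<close> onwards is kept.\<close>
    case True
    then obtain ys zs where "xs = ys @ a # zs" by (meson split_list)
    with xs show ?thesis
      by (intro exI[of _ "a # zs"]) (auto simp: successively_append_iff)
  next
    case False
    with xs step.hyps show ?thesis
      by (intro exI[of _ "a # xs"]) (auto simp: successively_Cons)
  qed
qed

text \<open>A path from \<open>b\<close> back to \<open>a\<close> that avoids the edge would close
  up with it to a cycle. The cycle has at least three vertices because the only two-vertex path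
  would use the deleted edge itself.\<close>

lemma tree_edge_is_bridge:
  assumes "is_tree E" "(a, b) \<in> E"
  shows "(b, a) \<notin> {(x, y). adj (E - {(a, b)}) x y}\<^sup>*"
proof
  assume "(b, a) \<in> {(x, y). adj (E - {(a, b)}) x y}\<^sup>*"
  from rtrancl_imp_distinct_path[OF this] obtain xs where
    xs: "xs \<noteq> []" "hd xs = b" "last xs = a" "distinct xs" "successively (adj (E - {(a, b)})) xs"
    by blast
  have "(b, a) \<notin> E" "a \<noteq> b" using assms by (auto simp: is_tree_def)
  then have "\<not> adj (E - {(a, b)}) b a" by (auto simp: adj_def)
  have "3 \<le> length xs"
  proof (rule ccontr)
    assume "\<not> 3 \<le> length xs"
    with xs(1) consider x where "xs = [x]" | x y where "xs = [x, y]"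
      by (cases xs; cases "tl xs"; cases "tl (tl xs)") auto
    then show False
      by cases (use xs \<open>a \<noteq> b\<close> \<open>\<not> adj (E - {(a, b)}) b a\<close> in auto)
  qed
  moreover have "successively (adj E) xs"
    using xs(5) by (rule successively_mono) (auto simp: adj_def)
  moreover have "adj E (last xs) (hd xs)"
    using assms(2) xs by (auto simp: adj_def)
  ultimately have "undirected_cycle E xs"
    using xs(4) by (auto simp: undirected_cycle_def)
  with assms(1) show False by (auto simp: is_tree_def)
qed

text \<open>Every edge \<open>e\<close> contributes the indicator of the component beyond \<open>e\<close> in the tree without \<open>e\<close>;
  no edge other than \<open>e\<close> crosses the boundary of that component.\<close>

lemma tree_potential:
  fixes \<phi> :: "'a::finite \<Rightarrow> 'a \<Rightarrow> real"
  assumes "is_tree E"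
  obtains \<theta> where "\<theta> r = 0" "\<And>i k. (i, k) \<in> E \<Longrightarrow> \<theta> i - \<theta> k = \<phi> i k"
proof -
  define S where "S e = {x. (snd e, x) \<in> {(x, y). adj (E - {e}) x y}\<^sup>*}" for e
  define T where "T x = (\<Sum>e\<in>E. - \<phi> (fst e) (snd e) * indicator (S e) x)" for x
  have T: "T i - T k = \<phi> i k" if e: "(i, k) \<in> E" for i k
  proof -
    \<comment> \<open>The edge from \<open>i\<close> to \<open>k\<close> survives the deletion of
      \<open>e\<close>, so both ends lie in the same component.\<close>
    have other: "indicator (S e) i = (indicator (S e) k :: real)" if "e \<in> E" "e \<noteq> (i, k)" for e
    proof -
      have "adj (E - {e}) i k" using e that by (auto simp: adj_def)
      then have "(i, k) \<in> {(x, y). adj (E - {e}) x y}" "(k, i) \<in> {(x, y). adj (E - {e}) x y}"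
        by (auto simp: adj_sym)
      then have "i \<in> S e \<longleftrightarrow> k \<in> S e"
        unfolding S_def by (auto intro: rtrancl_into_rtrancl)
      then show ?thesis by (auto simp: indicator_def)
    qed
    have "i \<notin> S (i, k)" "k \<in> S (i, k)"
      using tree_edge_is_bridge[OF assms e] by (auto simp: S_def)
    have "T i - T k
        = (\<Sum>e\<in>E. - \<phi> (fst e) (snd e) * (indicator (S e) i - indicator (S e) k))"
      by (simp add: T_def sum_subtractf[symmetric] algebra_simps)
    also have "\<dots> = (\<Sum>e\<in>{(i, k)}. - \<phi> (fst e) (snd e) * (indicator (S e) i - indicator (S e) k))"
      by (rule sum.mono_neutral_right) (use e other in auto)
    also have "\<dots> = \<phi> i k"
      using \<open>i \<notin> S (i, k)\<close> \<open>k \<in> S (i, k)\<close> by simp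
    finally show ?thesis .
  qed
  show ?thesis
    by (rule that[of "\<lambda>x. T x - T r"]) (use T in auto)
qed

text \<open>Summing over all buses and their neighbours visits each edge from both ends; the
  hypothesis makes \<open>E\<close> and its converse disjoint.\<close>

lemma sum_edges_symmetrize:
  fixes f :: "'a::finite \<Rightarrow> 'a \<Rightarrow> real"
  assumes "\<forall>u w. (u, w) \<in> E \<longrightarrow> (w, u) \<notin> E"
  shows "(\<Sum>(i, k)\<in>E. f i k + f k i) = (\<Sum>i\<in>UNIV. \<Sum>k\<in>nbrs E i. f i k)"
proof -
  have "(\<Sum>(i, k)\<in>E. f i k + f k i) = (\<Sum>(i, k)\<in>E. f i k) + (\<Sum>(i, k)\<in>E. f k i)"
    by (simp add: case_prod_unfold sum.distrib)
  also have "(\<Sum>(i, k)\<in>E. f k i) = (\<Sum>(i, k)\<in>E\<inverse>. f i k)"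
    by (rule sum.reindex_bij_witness[of _ prod.swap prod.swap]) auto
  also have "(\<Sum>(i, k)\<in>E. f i k) + (\<Sum>(i, k)\<in>E\<inverse>. f i k) = (\<Sum>(i, k)\<in>E \<union> E\<inverse>. f i k)"
    by (rule sum.union_disjoint[symmetric]) (use assms in auto)
  also have "E \<union> E\<inverse> = Sigma UNIV (nbrs E)"
    by (auto simp: nbrs_def adj_def)
  also have "(\<Sum>(i, k)\<in>Sigma UNIV (nbrs E). f i k) = (\<Sum>i\<in>UNIV. \<Sum>k\<in>nbrs E i. f i k)"
    by (rule sum.Sigma[symmetric]) auto
  finally show ?thesis .
qed

section \<open>Networks\<close>

lemma volt_simps [simp]: "volt v None = 1" "volt v (Some i) = v $ i"
  by (auto simp: volt_def)

lemma phase_simps [simp]: "phase v None = 0" "phase v (Some i) = v $ i"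
  by (auto simp: phase_def)

lemma phase_add: "phase (x + y) b = phase x b + phase y b"
  by (cases b) auto

lemma phase_diff: "phase (x - y) b = phase x b - phase y b"
  by (cases b) auto

lemma phase_scaleR: "phase (t *\<^sub>R y) b = t * phase y b"
  by (cases b) auto

lemma volt_pos: "positive v \<Longrightarrow> 0 < volt v b"
  by (cases b) (auto simp: positive_def)

lemma volt_mono: "(\<And>i. u $ i \<le> v $ i) \<Longrightarrow> volt u b \<le> volt v b"
  by (cases b) auto

text \<open>The negative part is nonincreasing and 1-Lipschitz. For equal signs both sides agree;
  for mixed signs the cross product has the right sign. This is the estimate on a single edge in the
  minimum principle.\<close>

lemma negative_part_monotone:
  "(max 0 (- a) - max 0 (- b)) * (a - b) \<le> - (max 0 (- a) - max 0 (- b))\<^sup>2" for a b :: real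
proof (cases "a \<le> 0"; cases "b \<le> 0")
  assume "a \<le> 0" "\<not> b \<le> 0"
  then show ?thesis using mult_nonpos_nonneg[of a b] by (simp add: power2_eq_square algebra_simps)
next
  assume "\<not> a \<le> 0" "b \<le> 0"
  then show ?thesis using mult_nonneg_nonpos[of a b] by (simp add: power2_eq_square algebra_simps)
qed (simp_all add: power2_eq_square algebra_simps)

locale radial_network =
  fixes E :: "'n::finite edges" and B :: "'n option \<Rightarrow> 'n option \<Rightarrow> real"
  assumes tree: "is_tree E" and oriented: "oriented_away_from None E"
    and weights: "edge_weights E B"
begin

lemma no_antiparallel: "(u, w) \<in> E \<Longrightarrow> (w, u) \<notin> E"
  using tree by (auto simp: is_tree_def)

lemma B_pos: "k \<in> nbrs E i \<Longrightarrow> 0 < B i k"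
  and B_sym: "k \<in> nbrs E i \<Longrightarrow> B k i = B i k"
  using weights by (metis edge_weights_def mem_Collect_eq nbrs_def)+

lemma nbrs_sym: "k \<in> nbrs E i \<longleftrightarrow> i \<in> nbrs E k"
  by (auto simp: nbrs_def adj_sym)

lemma edge_nbrs: "(i, k) \<in> E \<Longrightarrow> k \<in> nbrs E i" "(i, k) \<in> E \<Longrightarrow> i \<in> nbrs E k"
  by (auto simp: nbrs_def adj_def)

lemma edge_B: "(i, k) \<in> E \<Longrightarrow> 0 < B i k" "(i, k) \<in> E \<Longrightarrow> B k i = B i k"
  using B_pos B_sym edge_nbrs by blast+

text \<open>Induction along the directed path from the root: this is how the fixed data at bus 0
  determine quantities at all other buses.\<close>

lemma propagate_from_root:
  assumes "P None" "\<And>i k. (i, k) \<in> E \<Longrightarrow> P i \<Longrightarrow> P k"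
  shows "P b"
proof -
  have "(None, b) \<in> E\<^sup>*" using oriented by (auto simp: oriented_away_from_def)
  then show ?thesis by induction (use assms in blast)+
qed

lemma nbrs_nonempty: "nbrs E (Some i) \<noteq> {}"
proof -
  have "(None, Some i) \<in> E\<^sup>*" using oriented by (auto simp: oriented_away_from_def)
  then obtain k where "(k, Some i) \<in> E" by (cases rule: rtranclE) auto
  then show ?thesis using edge_nbrs by blast
qed

lemma Bsum_pos: "0 < Bsum E B (Some i)"
  unfolding Bsum_def by (rule sum_pos) (use B_pos nbrs_nonempty in auto)

text \<open>Discrete summation by parts. A test function vanishing at the root discards the one bus
  at which no balance equation is imposed.\<close>

lemma sum_edges_by_bus:
  fixes g :: "'n option \<Rightarrow> real"
  assumes "g None = 0"
  shows "(\<Sum>(i, k)\<in>E. g i * h i k + g k * h k i)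
       = (\<Sum>i\<in>UNIV. g (Some i) * (\<Sum>k\<in>nbrs E (Some i). h (Some i) k))"
proof -
  have "(\<Sum>(i, k)\<in>E. g i * h i k + g k * h k i) = (\<Sum>b\<in>UNIV. g b * (\<Sum>k\<in>nbrs E b. h b k))"
    using sum_edges_symmetrize[of E "\<lambda>i k. g i * h i k"] no_antiparallel
    by (simp add: sum_distrib_left)
  also have "\<dots> = (\<Sum>b\<in>range Some. g b * (\<Sum>k\<in>nbrs E b. h b k))"
    by (simp add: UNIV_option_conv assms)
  also have "\<dots> = (\<Sum>i\<in>UNIV. g (Some i) * (\<Sum>k\<in>nbrs E (Some i). h (Some i) k))"
    by (subst sum.reindex) auto
  finally show ?thesis .
qed

text \<open>The minimum principle, by testing the inequality with the negative part of \<open>x\<close>.\<close>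

lemma laplacian_nonneg_imp_nonneg:
  assumes "\<And>i. 0 \<le> (\<Sum>k\<in>nbrs E (Some i). B (Some i) k * (x $ i - phase x k))"
  shows "0 \<le> x $ i"
proof -
  define g where "g b = max 0 (- phase x b)" for b
  have "0 \<le> (\<Sum>i\<in>UNIV. g (Some i)
      * (\<Sum>k\<in>nbrs E (Some i). B (Some i) k * (phase x (Some i) - phase x k)))"
    by (rule sum_nonneg, rule mult_nonneg_nonneg) (use assms in \<open>auto simp: g_def\<close>)
  also have "\<dots> = (\<Sum>(i, k)\<in>E. g i * (B i k * (phase x i - phase x k))
      + g k * (B k i * (phase x k - phase x i)))"
    by (rule sum_edges_by_bus[symmetric]) (simp add: g_def)
  also have "\<dots> \<le> (\<Sum>(i, k)\<in>E. - (B i k * (g i - g k)\<^sup>2))"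
  proof (intro sum_mono, clarify)
    fix i k assume e: "(i, k) \<in> E"
    have "(g i - g k) * (phase x i - phase x k) \<le> - (g i - g k)\<^sup>2"
      unfolding g_def by (rule negative_part_monotone)
    then have "B i k * ((g i - g k) * (phase x i - phase x k)) \<le> B i k * (- (g i - g k)\<^sup>2)"
      using edge_B(1)[OF e] by (intro mult_left_mono) auto
    then show "g i * (B i k * (phase x i - phase x k)) + g k * (B k i * (phase x k - phase x i))
        \<le> - (B i k * (g i - g k)\<^sup>2)"
      by (simp add: edge_B(2)[OF e] algebra_simps)
  qed
  finally have "(\<Sum>(i, k)\<in>E. B i k * (g i - g k)\<^sup>2) \<le> 0"
    by (simp add: case_prod_unfold sum_negf)
  moreover have nn: "0 \<le> B i k * (g i - g k)\<^sup>2" if "(i, k) \<in> E" for i k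
    using edge_B(1)[OF that] by simp
  ultimately have "(\<Sum>(i, k)\<in>E. B i k * (g i - g k)\<^sup>2) = 0"
    by (intro antisym sum_nonneg) auto
  then have "\<forall>e\<in>E. (\<lambda>(i, k). B i k * (g i - g k)\<^sup>2) e = 0"
    by (subst (asm) sum_nonneg_eq_0_iff) (use nn in auto)
  \<comment> \<open>Zero Dirichlet energy makes \<open>g\<close> constant along edges, and its value
    at the root is 0.\<close>
  then have eq: "g i = g k" if "(i, k) \<in> E" for i k
    using that edge_B(1)[OF that] by force
  have "g b = 0" for b
    by (rule propagate_from_root) (use eq in \<open>auto simp: g_def\<close>)
  from this[of "Some i"] show ?thesis by (auto simp: g_def)
qed

text \<open>\<open>phase\<close> extends \<open>x\<close> by 0 to the root, so the edges to the
  root, present only in the diagonal of the matrix, become ordinary terms of the sum.\<close>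

lemma reduced_laplacian_apply:
  "(reduced_laplacian E B *v x) $ i = (\<Sum>k\<in>nbrs E (Some i). B (Some i) k * (x $ i - phase x k))"
proof -
  have i: "Some i \<notin> nbrs E (Some i)"
    using no_antiparallel by (auto simp: nbrs_def adj_def)
  have "(reduced_laplacian E B *v x) $ i
      = (\<Sum>k\<in>UNIV. (if i = k then Bsum E B (Some i) * x $ i else 0)
          - (if Some k \<in> nbrs E (Some i) then B (Some i) (Some k) * x $ k else 0))"
    unfolding matrix_vector_mult_def reduced_laplacian_def
    by (auto intro!: sum.cong simp: i)
  also have "\<dots> = Bsum E B (Some i) * x $ i
      - (\<Sum>k\<in>UNIV. if Some k \<in> nbrs E (Some i) then B (Some i) (Some k) * x $ k else 0)"
    by (simp add: sum_subtractf)
  also have "(\<Sum>k\<in>UNIV. if Some k \<in> nbrs E (Some i) then B (Some i) (Some k) * x $ k else 0)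
      = (\<Sum>b\<in>range Some. if b \<in> nbrs E (Some i) then B (Some i) b * phase x b else 0)"
    by (subst sum.reindex) (auto intro!: sum.cong)
  also have "\<dots> = (\<Sum>b\<in>UNIV. if b \<in> nbrs E (Some i) then B (Some i) b * phase x b else 0)"
    by (simp add: UNIV_option_conv)
  also have "\<dots> = (\<Sum>b\<in>nbrs E (Some i). B (Some i) b * phase x b)"
    by (simp add: sum.If_cases)
  finally show ?thesis
    by (simp add: Bsum_def sum_subtractf right_diff_distrib sum_distrib_right)
qed

lemma invertible_reduced_laplacian: "invertible (reduced_laplacian E B)"
proof -
  \<comment> \<open>The minimum principle applies to both \<open>x\<close> and
    \<open>- x\<close>.\<close>
  have "x = 0" if "reduced_laplacian E B *v x = 0" for x
  proof -
    have *: "(\<Sum>k\<in>nbrs E (Some i). B (Some i) k * (x $ i - phase x k)) = 0" for i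
      using that reduced_laplacian_apply[of x i] by simp
    have "phase (- x) b = - phase x b" for b by (cases b) auto
    then have "(\<Sum>k\<in>nbrs E (Some i). B (Some i) k * ((- x) $ i - phase (- x) k)) 
        = - (\<Sum>k\<in>nbrs E (Some i). B (Some i) k * (x $ i - phase x k))" for i
      by (simp add: sum_negf[symmetric] algebra_simps)
    then have "0 \<le> (- x) $ i" "0 \<le> x $ i" for i
      using * by (auto intro!: laplacian_nonneg_imp_nonneg simp del: vector_uminus_component)
    then show ?thesis by (auto simp: vec_eq_iff intro: antisym)
  qed
  then show ?thesis
    by (simp add: invertible_left_inverse matrix_left_invertible_ker)
qed

lemma reduced_laplacian_inv: "reduced_laplacian E B *v (matrix_inv (reduced_laplacian E B) *v x) = x"
  using someI_ex[OF invertible_reduced_laplacian[unfolded invertible_def]]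
  by (simp add: matrix_vector_mul_assoc matrix_inv_def)

text \<open>This is the system with every root replaced by an arithmetic mean. Its left side minus
  the sum is half the Laplacian difference of \<open>v\<close>; the 2 in \<open>v_max\<close>
  cancels that half, and the ones match the root voltage and drop out of differences.\<close>

lemma v_max_eq:
  "Bsum E B (Some i) * v_max E B q $ i
     = q $ i + (\<Sum>k\<in>nbrs E (Some i). B (Some i) k * ((v_max E B q $ i + volt (v_max E B q) k) / 2))"
proof -
  let ?y = "matrix_inv (reduced_laplacian E B) *v q"
  have "volt (v_max E B q) b = 1 + 2 * phase ?y b" for b
    by (cases b) (auto simp: v_max_def)
  from this[of "Some i"] this
  have "(\<Sum>k\<in>nbrs E (Some i). B (Some i) k * ((v_max E B q $ i + volt (v_max E B q) k) / 2))
      = (\<Sum>k\<in>nbrs E (Some i). B (Some i) k * v_max E B q $ i - B (Some i) k * (?y $ i - phase ?y k))"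
    by (intro sum.cong) (auto simp: field_simps)
  also have "\<dots> = Bsum E B (Some i) * v_max E B q $ i - q $ i"
    using reduced_laplacian_apply[of ?y i] reduced_laplacian_inv[of q]
    by (simp add: sum_subtractf Bsum_def sum_distrib_right)
  finally show ?thesis by simp
qed

text \<open>Comparison principle: subtracting the equation for \<open>v_max\<close> shows that the
  Laplacian of the difference is nonnegative.\<close>

lemma le_v_max:
  assumes "\<And>i. Bsum E B (Some i) * v $ i
     \<le> q $ i + (\<Sum>k\<in>nbrs E (Some i). B (Some i) k * ((v $ i + volt v k) / 2))"
  shows "v $ i \<le> v_max E B q $ i"
proof -
  let ?u = "v_max E B q"
  have d: "phase (?u - v) b = volt ?u b - volt v b" for b
    by (cases b) auto
  have "0 \<le> (?u - v) $ i"
  proof (rule laplacian_nonneg_imp_nonneg)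
    fix i
    have "0 \<le> (Bsum E B (Some i) * ?u $ i - (\<Sum>k\<in>nbrs E (Some i). B (Some i) k * ((?u $ i + volt ?u k) / 2)))
       - (Bsum E B (Some i) * v $ i - (\<Sum>k\<in>nbrs E (Some i). B (Some i) k * ((v $ i + volt v k) / 2)))"
      using assms[of i] v_max_eq[of i q] by simp
    also have "\<dots> = (\<Sum>k\<in>nbrs E (Some i). B (Some i) k * ((?u - v) $ i - phase (?u - v) k) / 2)"
      unfolding Bsum_def sum_distrib_right sum_subtractf[symmetric] d
      by (rule sum.cong) (auto simp: field_simps)
    also have "\<dots> = (\<Sum>k\<in>nbrs E (Some i). B (Some i) k * ((?u - v) $ i - phase (?u - v) k)) / 2"
      by (simp only: sum_divide_distrib)
    finally show "0 \<le> (\<Sum>k\<in>nbrs E (Some i). B (Some i) k * ((?u - v) $ i - phase (?u - v) k))"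
      by simp
  qed
  then show ?thesis by simp
qed

subsection \<open>Flows\<close>

text \<open>A circulation vanishing at all non-root buses is orthogonal to all potential
  differences, and on a tree it is itself a potential difference.\<close>

lemma circulation_eq_zero:
  assumes "\<forall>i k. r k i = - r i k" "\<forall>i k. \<not> adj E i k \<longrightarrow> r i k = 0"
    and "\<forall>i. (\<Sum>k\<in>nbrs E (Some i). B (Some i) k * r (Some i) k) = 0"
  shows "r = (\<lambda>i k. 0)"
proof -
  obtain \<theta> where \<theta>: "\<theta> None = 0" "\<And>i k. (i, k) \<in> E \<Longrightarrow> \<theta> i - \<theta> k = r i k"
    using tree_potential[OF tree] by metis
  have "(\<Sum>(i, k)\<in>E. B i k * (r i k)\<^sup>2)
      = (\<Sum>(i, k)\<in>E. \<theta> i * (B i k * r i k) + \<theta> k * (B k i * r k i))"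
  proof (rule sum.cong[OF refl], clarify)
    fix i k assume e: "(i, k) \<in> E"
    show "B i k * (r i k)\<^sup>2 = \<theta> i * (B i k * r i k) + \<theta> k * (B k i * r k i)"
      unfolding edge_B(2)[OF e] assms(1)[rule_format, of k i]
      by (simp add: \<theta>(2)[OF e, symmetric] power2_eq_square algebra_simps)
  qed
  also have "\<dots> = 0"
    using assms(3) \<theta>(1) by (subst sum_edges_by_bus) auto
  finally have "\<forall>e\<in>E. (\<lambda>(i, k). B i k * (r i k)\<^sup>2) e = 0"
    by (subst (asm) sum_nonneg_eq_0_iff) (use edge_B in \<open>auto simp: less_imp_le\<close>)
  then have "r i k = 0" if "(i, k) \<in> E" for i k
    using that edge_B(1)[OF that] by force
  then have "r i k = 0" for i k
    using assms(1,2) by (metis add.inverse_neutral adj_def)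
  then show ?thesis by blast
qed

lemma flow_unique:
  assumes "\<forall>i k. s k i = - s i k" "\<forall>i k. \<not> adj E i k \<longrightarrow> s i k = 0"
    "\<forall>i. (\<Sum>k\<in>nbrs E (Some i). B (Some i) k * s (Some i) k) = p $ i"
    and "\<forall>i k. s' k i = - s' i k" "\<forall>i k. \<not> adj E i k \<longrightarrow> s' i k = 0"
    "\<forall>i. (\<Sum>k\<in>nbrs E (Some i). B (Some i) k * s' (Some i) k) = p $ i"
  shows "s = s'"
proof -
  have "\<forall>i k. s k i - s' k i = - (s i k - s' i k)"
    by (metis assms(1,4) minus_diff_minus)
  then have "(\<lambda>i k. s i k - s' i k) = (\<lambda>i k. 0)"
    by (rule circulation_eq_zero)
      (use assms(2,3,5,6) in \<open>simp_all add: right_diff_distrib sum_subtractf\<close>)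
  then show ?thesis by (simp add: fun_eq_iff)
qed

text \<open>Existence behind the definite description \<open>flow\<close>: the potential differences
  of the solution of the Laplace equation with right-hand side \<open>p\<close> solve the
  system.\<close>

lemma flow_props:
  shows flow_antisym: "flow E B p k i = - flow E B p i k"
    and flow_off_edges: "\<not> adj E i k \<Longrightarrow> flow E B p i k = 0"
    and flow_balance: "(\<Sum>k\<in>nbrs E (Some j). B (Some j) k * flow E B p (Some j) k) = p $ j"
proof -
  define \<theta> where "\<theta> = matrix_inv (reduced_laplacian E B) *v p"
  define s where "s = on_edges E (\<lambda>i k. phase \<theta> i - phase \<theta> k)"
  have "(\<Sum>k\<in>nbrs E (Some i). B (Some i) k * s (Some i) k) = (reduced_laplacian E B *v \<theta>) $ i" for i
    unfolding reduced_laplacian_apply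
    by (rule sum.cong) (auto simp: s_def on_edges_def nbrs_def)
  then have s: "(\<forall>i k. s k i = - s i k) \<and> (\<forall>i k. \<not> adj E i k \<longrightarrow> s i k = 0)
      \<and> (\<forall>i. (\<Sum>k\<in>nbrs E (Some i). B (Some i) k * s (Some i) k) = p $ i)"
    by (auto simp: s_def on_edges_def \<theta>_def reduced_laplacian_inv adj_sym)
  have "(\<forall>i k. flow E B p k i = - flow E B p i k) \<and> (\<forall>i k. \<not> adj E i k \<longrightarrow> flow E B p i k = 0)
      \<and> (\<forall>i. (\<Sum>k\<in>nbrs E (Some i). B (Some i) k * flow E B p (Some i) k) = p $ i)"
    unfolding flow_def
    by (rule theI[of _ s]) (use s flow_unique[of _ p] in \<open>blast+\<close>)
  then show "flow E B p k i = - flow E B p i k" "\<not> adj E i k \<Longrightarrow> flow E B p i k = 0"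
    "(\<Sum>k\<in>nbrs E (Some j). B (Some j) k * flow E B p (Some j) k) = p $ j"
    by blast+
qed

lemma flow_eqI:
  assumes "\<forall>i k. s k i = - s i k" "\<forall>i k. \<not> adj E i k \<longrightarrow> s i k = 0"
    "\<forall>i. (\<Sum>k\<in>nbrs E (Some i). B (Some i) k * s (Some i) k) = p $ i"
  shows "s = flow E B p"
  by (rule flow_unique[OF assms]) (use flow_props in blast)+


subsection \<open>The greatest feasible point of the relaxation\<close>

lemma nbrs_cases:
  assumes "k \<in> nbrs E i"
  obtains "(i, k) \<in> E" | "(k, i) \<in> E"
  using assms by (auto simp: nbrs_def adj_def)

lemma flow_square_sym: "(flow E B p k i)\<^sup>2 = (flow E B p i k)\<^sup>2"
  by (subst flow_antisym) simp

lemma root_term_sym: "root_term E B p v k i = root_term E B p v i k"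
  by (simp add: root_term_def flow_square_sym[of p k i] mult.commute)

lemma volt_mult_mono:
  assumes "positive u" "\<And>i. u $ i \<le> v $ i"
  shows "volt u i * volt u k \<le> volt v i * volt v k"
  by (intro mult_mono volt_mono assms less_imp_le[OF volt_pos[OF assms(1)]])
    (meson assms less_imp_le order_trans volt_mono volt_pos)

lemma root_term_mono:
  assumes "positive u" "\<And>i. u $ i \<le> v $ i"
  shows "root_term E B p u i k \<le> root_term E B p v i k"
  using volt_mult_mono[OF assms, of i k] by (simp add: root_term_def)

lemma root_term_le_mean:
  assumes "positive v"
  shows "root_term E B p v i k \<le> (volt v i + volt v k) / 2"
proof -
  have "root_term E B p v i k \<le> sqrt (volt v i * volt v k)"
    by (simp add: root_term_def)
  also have "\<dots> \<le> (volt v i + volt v k) / 2"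
    by (rule arith_geo_mean_sqrt) (use volt_pos[OF assms] in \<open>auto simp: less_imp_le\<close>)
  finally show ?thesis .
qed

lemma sqrt_definedD:
  "sqrt_defined E B p v \<Longrightarrow> k \<in> nbrs E i \<Longrightarrow> (flow E B p i k)\<^sup>2 \<le> volt v i * volt v k"
  by (erule nbrs_cases) (auto simp: sqrt_defined_def flow_square_sym[of p k i] mult.commute)

lemma positive_mono: "positive u \<Longrightarrow> (\<And>i. u $ i \<le> v $ i) \<Longrightarrow> positive v"
  unfolding positive_def by (meson less_le_trans)

lemma sqrt_defined_mono:
  "sqrt_defined E B p u \<Longrightarrow> positive u \<Longrightarrow> (\<And>i. u $ i \<le> v $ i) \<Longrightarrow> sqrt_defined E B p v"
  using volt_mult_mono[of u v] unfolding sqrt_defined_def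
  by (smt (verit, best) case_prodI2 case_prodD)

lemma fp_map_nth:
  "fp_map E B p q v $ i
     = (q $ i + (\<Sum>k\<in>nbrs E (Some i). B (Some i) k * root_term E B p v (Some i) k)) / Bsum E B (Some i)"
  by (simp add: fp_map_def add_divide_distrib sum_divide_distrib)

text \<open>Feasible points are thus subsolutions, and tight points are fixed points, of the
  monotone map \<open>g\<close>; this ties the relaxation to the iteration.\<close>

lemma relaxation_lhs_le_iff: "relaxation_lhs E B p v i \<le> q $ i \<longleftrightarrow> v $ i \<le> fp_map E B p q v $ i"
  and relaxation_lhs_eq_iff: "relaxation_lhs E B p v i = q $ i \<longleftrightarrow> v $ i = fp_map E B p q v $ i"
  using Bsum_pos[of i] by (auto simp: relaxation_lhs_def fp_map_nth field_simps)

lemma fp_map_mono: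
  assumes "positive u" "\<And>i. u $ i \<le> v $ i"
  shows "fp_map E B p q u $ i \<le> fp_map E B p q v $ i"
  unfolding fp_map_nth
  by (intro divide_right_mono add_left_mono sum_mono mult_left_mono root_term_mono assms)
    (use Bsum_pos B_pos in \<open>auto simp: less_imp_le\<close>)

lemma sum_root_term_le_mean:
  assumes "positive v"
  shows "(\<Sum>k\<in>nbrs E (Some i). B (Some i) k * root_term E B p v (Some i) k)
    \<le> (\<Sum>k\<in>nbrs E (Some i). B (Some i) k * ((v $ i + volt v k) / 2))"
proof (rule sum_mono, rule mult_left_mono)
  show "root_term E B p v (Some i) k \<le> (v $ i + volt v k) / 2" for k
    using root_term_le_mean[OF assms, of p "Some i" k] by simp
qed (use B_pos in \<open>auto simp: less_imp_le\<close>)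

lemma feasible_le_v_max:
  assumes "relaxation_feasible E B p q v"
  shows "v $ i \<le> v_max E B q $ i"
proof (rule le_v_max)
  fix i
  have "Bsum E B (Some i) * v $ i
      \<le> q $ i + (\<Sum>k\<in>nbrs E (Some i). B (Some i) k * root_term E B p v (Some i) k)"
    using assms by (simp add: relaxation_feasible_def relaxation_lhs_def field_simps)
  then show "Bsum E B (Some i) * v $ i
      \<le> q $ i + (\<Sum>k\<in>nbrs E (Some i). B (Some i) k * ((v $ i + volt v k) / 2))"
    using sum_root_term_le_mean[of v i p] assms by (simp add: relaxation_feasible_def)
qed

lemma fp_map_v_max_le:
  assumes "positive (v_max E B q)"
  shows "fp_map E B p q (v_max E B q) $ i \<le> v_max E B q $ i"
  using sum_root_term_le_mean[OF assms, of i p] v_max_eq[of i q] Bsum_pos[of i]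
  unfolding fp_map_nth by (simp add: pos_divide_le_eq mult.commute)

lemma fp_iterate_Suc: "fp_iterate E B p q (Suc j) = fp_map E B p q (fp_iterate E B p q j)"
  by (simp add: fp_iterate_def)

lemma feasible_le_fp_iterate:
  assumes "relaxation_feasible E B p q v"
  shows "v $ i \<le> fp_iterate E B p q j $ i"
proof (induction j arbitrary: i)
  case 0
  show ?case using feasible_le_v_max[OF assms] by (simp add: fp_iterate_def)
next
  case (Suc j)
  have "v $ i \<le> fp_map E B p q v $ i"
    using assms by (simp add: relaxation_feasible_def relaxation_lhs_le_iff)
  also have "\<dots> \<le> fp_map E B p q (fp_iterate E B p q j) $ i"
    by (rule fp_map_mono) (use assms Suc in \<open>auto simp: relaxation_feasible_def\<close>)
  finally show ?case by (simp add: fp_iterate_Suc)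
qed

lemma fp_iterate_decreasing:
  assumes "relaxation_feasible E B p q v"
  shows "fp_iterate E B p q (Suc j) $ i \<le> fp_iterate E B p q j $ i"
proof (induction j arbitrary: i)
  \<comment> \<open>Positivity of the iterates comes from the feasible point below them;
    monotonicity of \<open>g\<close> is available only above a positive vector.\<close>
  have pos: "positive (fp_iterate E B p q j)" for j
    by (rule positive_mono[OF _ feasible_le_fp_iterate[OF assms]])
      (use assms in \<open>simp add: relaxation_feasible_def\<close>)
  {
    case 0
    show ?case
      using fp_map_v_max_le[of q p i] pos[of 0] by (simp add: fp_iterate_def)
  next
    case (Suc j)
    show ?case
      unfolding fp_iterate_Suc[of _ _ "Suc j"] fp_iterate_Suc[of p q j]
      by (rule fp_map_mono[OF pos[of "Suc j", unfolded fp_iterate_Suc] Suc[unfolded fp_iterate_Suc]])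
  }
qed

text \<open>Greatest componentwise, hence independent of the weights \<open>w\<close>; it is the
  common reference point to which all three approaches are compared.\<close>

definition greatest_feasible :: "real ^ 'n \<Rightarrow> real ^ 'n \<Rightarrow> real ^ 'n \<Rightarrow> bool" where
  "greatest_feasible p q v \<longleftrightarrow> relaxation_feasible E B p q v
     \<and> (\<forall>u. relaxation_feasible E B p q u \<longrightarrow> (\<forall>i. u $ i \<le> v $ i))"

lemma fp_map_tendsto:
  assumes "X \<longlonglongrightarrow> v"
  shows "(\<lambda>j. fp_map E B p q (X j)) \<longlonglongrightarrow> fp_map E B p q v"
proof (rule vec_tendstoI)
  fix i
  have volt: "(\<lambda>j. volt (X j) b) \<longlonglongrightarrow> volt v b" for b
    by (cases b) (auto intro: tendsto_vec_nth assms)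
  show "(\<lambda>j. fp_map E B p q (X j) $ i) \<longlonglongrightarrow> fp_map E B p q v $ i"
    unfolding fp_map_nth root_term_def
    by (intro tendsto_intros volt) (use Bsum_pos[of i] in auto)
qed

text \<open>The iterates decrease and stay above every feasible point, so they converge. Continuity
  makes the limit a fixed point, and the limit inherits all the lower bounds.\<close>

lemma greatest_feasible_exists:
  assumes "relaxation_feasible E B p q v"
  obtains v' where "greatest_feasible p q v'" "fp_map E B p q v' = v'"
    "fp_iterate E B p q \<longlonglongrightarrow> v'"
    "\<And>j. positive (fp_iterate E B p q j)" "\<And>j. sqrt_defined E B p (fp_iterate E B p q j)"
proof -
  let ?X = "fp_iterate E B p q"
  have v: "positive v" "sqrt_defined E B p v" using assms by (auto simp: relaxation_feasible_def)
  have "\<exists>l. (\<lambda>j. ?X j $ i) \<longlonglongrightarrow> l" for i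
  proof -
    have "decseq (\<lambda>j. ?X j $ i)"
      by (rule decseq_SucI) (rule fp_iterate_decreasing[OF assms])
    then show ?thesis
      using feasible_le_fp_iterate[OF assms] by (blast elim: decseq_convergent)
  qed
  then obtain l where l: "\<And>i. (\<lambda>j. ?X j $ i) \<longlonglongrightarrow> l i" by metis
  define v' where "v' = (\<chi> i. l i)"
  have lim: "?X \<longlonglongrightarrow> v'"
    by (rule vec_tendstoI) (simp add: v'_def l)
  have "(\<lambda>j. ?X (Suc j)) \<longlonglongrightarrow> fp_map E B p q v'"
    unfolding fp_iterate_Suc by (rule fp_map_tendsto[OF lim])
  with LIMSEQ_Suc[OF lim] have fp: "fp_map E B p q v' = v'"
    using LIMSEQ_unique by blast
  have ge: "u $ i \<le> v' $ i" if "relaxation_feasible E B p q u" for u i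
    using feasible_le_fp_iterate[OF that] by (auto intro: LIMSEQ_le_const[OF l] simp: v'_def)
  have "relaxation_feasible E B p q v'"
    unfolding relaxation_feasible_def relaxation_lhs_le_iff fp
    using positive_mono[OF v(1) ge[OF assms]] sqrt_defined_mono[OF v(2,1) ge[OF assms]] by simp
  then show ?thesis
    using ge positive_mono[OF v(1) feasible_le_fp_iterate[OF assms]]
      sqrt_defined_mono[OF v(2,1) feasible_le_fp_iterate[OF assms]]
    by (intro that[of v'] fp lim) (auto simp: greatest_feasible_def)
qed

lemma greatest_feasible_unique:
  "greatest_feasible p q u \<Longrightarrow> greatest_feasible p q v \<Longrightarrow> u = v"
  by (auto simp: greatest_feasible_def vec_eq_iff intro: antisym)

lemma greatest_feasible_fp_map:
  "greatest_feasible p q v \<Longrightarrow> fp_map E B p q v = v"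
  by (metis greatest_feasible_def greatest_feasible_exists greatest_feasible_unique)

lemma fixed_point_computes_iff:
  assumes "greatest_feasible p q v"
  shows "fixed_point_computes E B p q y \<longleftrightarrow> y = (v, flow E B p, on_edges E (root_term E B p v))"
proof -
  have "relaxation_feasible E B p q v" using assms by (simp add: greatest_feasible_def)
  from greatest_feasible_exists[OF this] obtain v' where v': "greatest_feasible p q v'"
    "fp_map E B p q v' = v'" "fp_iterate E B p q \<longlonglongrightarrow> v'"
    "\<And>j. positive (fp_iterate E B p q j)" "\<And>j. sqrt_defined E B p (fp_iterate E B p q j)"
    by metis
  moreover have "v' = v" by (rule greatest_feasible_unique[OF v'(1) assms])
  moreover from this have "fp_iterate E B p q \<longlonglongrightarrow> u \<longleftrightarrow> u = v" for u
    using v'(3) LIMSEQ_unique by blast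
  ultimately show ?thesis
    using assms
    by (cases y) (auto simp: fixed_point_computes_def greatest_feasible_def relaxation_feasible_def)
qed

lemma relaxation_objective_strict_mono:
  assumes "\<forall>i. 0 < w $ i" "positive u" "\<And>i. u $ i \<le> v $ i" "u \<noteq> v"
  shows "relaxation_objective w u < relaxation_objective w v"
  unfolding relaxation_objective_def
proof (rule sum_strict_mono_ex1)
  have "positive v" using assms(2,3) by (rule positive_mono)
  then show "\<forall>i\<in>UNIV. w $ i * ln (u $ i) \<le> w $ i * ln (v $ i)"
    using assms by (auto simp: positive_def intro!: mult_left_mono less_imp_le)
  obtain i where "u $ i < v $ i" using assms(3,4) by (metis antisym_conv2 vec_eq_iff)
  then show "\<exists>i\<in>UNIV. w $ i * ln (u $ i) < w $ i * ln (v $ i)"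
    using assms(1,2) \<open>positive v\<close> by (auto simp: positive_def)
qed simp

text \<open>Any other feasible point lies below \<open>v\<close> and strictly below it in some
  component, so its objective is strictly smaller.\<close>

lemma relaxation_computes_iff:
  assumes "greatest_feasible p q v" "\<forall>i. 0 < w $ i"
  shows "relaxation_computes E B p q w y \<longleftrightarrow> y = (v, flow E B p, on_edges E (root_term E B p v))"
proof -
  have v: "relaxation_feasible E B p q v" "\<And>u i. relaxation_feasible E B p q u \<Longrightarrow> u $ i \<le> v $ i"
    using assms by (auto simp: greatest_feasible_def)
  have "relaxation_objective w u < relaxation_objective w v"
    if "relaxation_feasible E B p q u" "u \<noteq> v" for u
    using that v by (intro relaxation_objective_strict_mono assms) (auto simp: relaxation_feasible_def)
  then have "relaxation_optimal E B p q w u \<longleftrightarrow> u = v" for u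
    using v(1) unfolding relaxation_optimal_def by (metis less_le_not_le order_refl)
  moreover have "\<forall>i. relaxation_lhs E B p v i = q $ i"
    unfolding relaxation_lhs_eq_iff greatest_feasible_fp_map[OF assms(1)] by simp
  ultimately show ?thesis
    by (auto simp: relaxation_computes_def split: prod.splits)
qed

text \<open>(PF) fixes only the square of \<open>c\<close>, so \<open>c\<close> is at most the
  nonnegative root and the balance equation turns into an inequality.\<close>

lemma power_flow_solution_imp_feasible:
  assumes "power_flow_solution E B p q (v, s, c)"
  shows "relaxation_feasible E B p q v"
proof -
  have v: "positive v" and s: "s = flow E B p" and sym: "\<And>i k. c i k = c k i"
    and eq: "\<And>i. Bsum E B (Some i) * v $ i - (\<Sum>k\<in>nbrs E (Some i). B (Some i) k * c (Some i) k) = q $ i"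
    and circ: "\<And>i k. (i, k) \<in> E \<Longrightarrow> (s i k)\<^sup>2 + (c i k)\<^sup>2 = volt v i * volt v k"
    using assms by (auto simp: power_flow_solution_def)
  have "sqrt_defined E B p v"
    unfolding sqrt_defined_def using circ s
    by (metis (mono_tags, lifting) case_prodI2 le_add_same_cancel1 zero_le_power2)
  moreover have "relaxation_lhs E B p v i \<le> q $ i" for i
  proof -
    have "(flow E B p a k)\<^sup>2 + (c a k)\<^sup>2 = volt v a * volt v k" if "k \<in> nbrs E a" for a k
      using that
    proof (cases rule: nbrs_cases)
      case 2
      then show ?thesis
        using circ[OF 2] by (simp add: s sym[of a k] flow_square_sym[of p k a] mult.commute)
    qed (use circ s in auto)
    then have "c a k \<le> root_term E B p v a k" if "k \<in> nbrs E a" for a k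
      unfolding root_term_def using that by (intro real_le_rsqrt) (smt (verit))
    then have "(\<Sum>k\<in>nbrs E (Some i). B (Some i) k * c (Some i) k)
        \<le> (\<Sum>k\<in>nbrs E (Some i). B (Some i) k * root_term E B p v (Some i) k)"
      by (intro sum_mono mult_left_mono) (use B_pos in \<open>auto simp: less_imp_le\<close>)
    then show ?thesis using eq[of i] by (simp add: relaxation_lhs_def)
  qed
  ultimately show ?thesis using v by (simp add: relaxation_feasible_def)
qed

lemma tight_imp_power_flow_solution:
  assumes "positive v" "sqrt_defined E B p v" "\<And>i. relaxation_lhs E B p v i = q $ i"
  shows "power_flow_solution E B p q (v, flow E B p, on_edges E (root_term E B p v))"
proof -
  have "(\<Sum>k\<in>nbrs E (Some i). B (Some i) k * on_edges E (root_term E B p v) (Some i) k)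
      = (\<Sum>k\<in>nbrs E (Some i). B (Some i) k * root_term E B p v (Some i) k)" for i
    by (rule sum.cong) (auto simp: on_edges_def nbrs_def)
  moreover have "(root_term E B p v i k)\<^sup>2 = volt v i * volt v k - (flow E B p i k)\<^sup>2"
    if "(i, k) \<in> E" for i k
    using assms(2) that by (auto simp: root_term_def sqrt_defined_def)
  ultimately show ?thesis
    using assms unfolding power_flow_solution_def relaxation_lhs_def
    by (auto simp: on_edges_def adj_sym root_term_sym) (auto simp: adj_def)
qed

end

section \<open>Minimal eigenvectors of symmetric matrices\<close>

lemma inner_matrix_vector_symmetric:
  fixes A :: "real ^ 'n::finite ^ 'n"
  assumes "transpose A = A"
  shows "x \<bullet> (A *v y) = y \<bullet> (A *v x)"
  by (metis assms dot_lmul_matrix inner_commute vector_transpose_matrix)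

text \<open>If passing to componentwise absolute values never increases the quadratic form, then
  a minimizer of the form on the unit sphere can be taken nonnegative; it is an eigenvector.\<close>

lemma nonneg_eigenvector_of_negative_eigenvalue:
  fixes A :: "real ^ 'n::finite ^ 'n"
  assumes sym: "transpose A = A"
    and abs: "\<And>x. (\<chi> i. \<bar>x $ i\<bar>) \<bullet> (A *v (\<chi> i. \<bar>x $ i\<bar>)) \<le> x \<bullet> (A *v x)"
    and neg: "x0 \<bullet> (A *v x0) < 0"
  obtains y \<mu> where "\<mu> < 0" "\<And>i. 0 \<le> y $ i" "y \<noteq> 0" "A *v y = \<mu> *\<^sub>R y"
proof -
  define Q where "Q x = x \<bullet> (A *v x)" for x
  have "continuous_on (sphere 0 1) Q"
    unfolding Q_def by (intro continuous_intros)
  then obtain z where z: "norm z = 1" "\<And>x. norm x = 1 \<Longrightarrow> Q z \<le> Q x"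
    using continuous_attains_inf[of "sphere 0 1" Q] by auto
  define y where "y = (\<chi> i. \<bar>z $ i\<bar>)"
  have "y \<bullet> y = z \<bullet> z" by (simp add: y_def inner_vec_def)
  then have y1: "y \<bullet> y = 1" using z(1) by (simp add: norm_eq_1)
  then have "norm y = 1" by (simp add: norm_eq_1)
  \<comment> \<open>Taking absolute values keeps the norm and does not increase \<open>Q\<close>, so
    \<open>y\<close> is a minimizer too.\<close>
  have Qy: "Q y = Q z"
    using z(2)[of y] abs[of z] \<open>norm y = 1\<close> by (simp add: Q_def y_def)
  define \<mu> where "\<mu> = Q y"
  have lower: "\<mu> * (x \<bullet> x) \<le> Q x" for x
  proof (cases "x = 0")
    case False
    have "Q y \<le> Q ((1 / norm x) *\<^sub>R x)"
      unfolding Qy by (rule z(2)) (use False in simp)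
    also have "\<dots> = Q x / (x \<bullet> x)"
      by (simp add: Q_def matrix_vector_mult_scaleR power2_norm_eq_inner[symmetric] power2_eq_square)
    finally show ?thesis
      using False by (simp add: \<mu>_def pos_le_divide_eq)
  qed (simp add: Q_def)
  have "\<mu> < 0"
  proof (rule ccontr)
    assume "\<not> \<mu> < 0"
    then have "0 \<le> \<mu> * (x0 \<bullet> x0)" by simp
    with lower[of x0] neg show False by (simp add: Q_def)
  qed
  moreover have "A *v y = \<mu> *\<^sub>R y"
  proof (rule ccontr)
    assume "A *v y \<noteq> \<mu> *\<^sub>R y"
    define w where "w = A *v y - \<mu> *\<^sub>R y"
    define g where "g = w \<bullet> w"
    define h where "h = Q w - \<mu> * (w \<bullet> w)"
    \<comment> \<open>First variation at \<open>y\<close> along the residual \<open>w\<close>: the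
      excess of \<open>Q\<close> over \<open>\<mu>\<close> times the squared norm at
      \<open>y + t w\<close> is \<open>2 t g + t^2 h\<close>, negative for small negative
      \<open>t\<close>. The denominator is \<open>h + 1\<close> because \<open>h\<close> may be
      0.\<close>
    define t where "t = - g / (h + 1)"
    have "0 < g" using \<open>A *v y \<noteq> \<mu> *\<^sub>R y\<close> by (simp add: g_def w_def)
    have "0 \<le> h" using lower[of w] by (simp add: h_def)
    have eq1: "Q (y + t *\<^sub>R w) = \<mu> + 2 * t * (w \<bullet> (A *v y)) + t\<^sup>2 * Q w"
      using inner_matrix_vector_symmetric[OF sym, of y w]
      by (simp add: \<mu>_def Q_def matrix_vector_right_distrib matrix_vector_mult_scaleR inner_add_left
          inner_add_right power2_eq_square algebra_simps)
    have eq2: "(y + t *\<^sub>R w) \<bullet> (y + t *\<^sub>R w) = 1 + 2 * t * (w \<bullet> y) + t\<^sup>2 * (w \<bullet> w)"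
      using y1 by (simp add: inner_add_left inner_add_right power2_eq_square inner_commute algebra_simps)
    have "w \<bullet> (A *v y) = g + \<mu> * (w \<bullet> y)"
      unfolding g_def by (subst (3) w_def) (simp add: inner_diff_right)
    with lower[of "y + t *\<^sub>R w"] have "0 \<le> 2 * t * g + t\<^sup>2 * h"
      unfolding h_def eq1 eq2 by (simp add: algebra_simps)
    also have "2 * t * g + t\<^sup>2 * h = - (g\<^sup>2 * (h + 2)) / (h + 1)\<^sup>2"
      using \<open>0 \<le> h\<close> by (simp add: t_def power2_eq_square divide_simps) (simp add: algebra_simps)
    also have "\<dots> < 0"
      using \<open>0 < g\<close> \<open>0 \<le> h\<close> by (intro divide_neg_pos) auto
    finally show False by simp
  qed
  moreover have "y \<noteq> 0" using y1 by auto
  ultimately show ?thesis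
    by (intro that[of \<mu> y]) (auto simp: y_def)
qed

section \<open>The quadratic form of the energy matrix\<close>

lemma inner_outer: "x \<bullet> (outer z *v y) = (x \<bullet> z) * (z \<bullet> y)"
proof -
  have "outer z *v y = (z \<bullet> y) *\<^sub>R z"
    by (simp add: outer_def matrix_vector_mult_def inner_vec_def vec_eq_iff sum_distrib_left mult_ac)
  then show ?thesis by simp
qed

lemma inner_unit_vec [simp]: "unit_vec b \<bullet> x = phase x b" "x \<bullet> unit_vec b = phase x b"
  by (cases b; simp add: unit_vec_def inner_axis inner_axis')+

lemma cos_term_sym: "cos_term v \<theta> k i = cos_term v \<theta> i k"
  using cos_minus[of "phase \<theta> i - phase \<theta> k"] by (simp add: cos_term_def mult.commute)

lemma sin_term_antisym: "sin_term v \<theta> k i = - sin_term v \<theta> i k"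
  using sin_minus[of "phase \<theta> i - phase \<theta> k"] by (simp add: sin_term_def mult.commute)

context radial_network begin

definition edge_coeff :: "real ^ 'n \<Rightarrow> real ^ 'n \<Rightarrow> 'n option \<Rightarrow> 'n option \<Rightarrow> real" where
  "edge_coeff v \<theta> i k = B i k * volt v i * volt v k / cos_term v \<theta> i k"

lemma edge_coeff_sym: "(i, k) \<in> E \<Longrightarrow> edge_coeff v \<theta> k i = edge_coeff v \<theta> i k"
  by (simp add: edge_coeff_def cos_term_sym[of v \<theta> k i] edge_B mult.commute mult.left_commute)

lemma inner_energy_matrix:
  "x \<bullet> (energy_matrix E B v \<theta> *v y)
     = (\<Sum>i\<in>UNIV. 2 * Bsum E B (Some i) * v $ i * x $ i * y $ i)
     - (\<Sum>(i, k)\<in>E. edge_coeff v \<theta> i k * (phase x i + phase x k) * (phase y i + phase y k))"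
proof -
  have lin: "linear (\<lambda>A. x \<bullet> (A *v y))"
    by (rule linearI)
      (auto simp: matrix_vector_mult_add_rdistrib inner_add_right scaleR_matrix_vector_assoc[symmetric])
  show ?thesis
    unfolding energy_matrix_def linear_diff[OF lin] linear_sum[OF lin] case_prod_unfold linear_scale[OF lin] inner_outer
    by (simp add: edge_coeff_def inner_add_left inner_add_right mult.assoc)
qed

lemma transpose_energy_matrix: "transpose (energy_matrix E B v \<theta>) = energy_matrix E B v \<theta>"
proof -
  have "A $ i $ k = axis i 1 \<bullet> (A *v axis k 1)" for A :: "real ^ 'n ^ 'n" and i k
    by (simp add: inner_axis' matrix_vector_mul_component inner_axis)
  moreover have "x \<bullet> (energy_matrix E B v \<theta> *v y) = y \<bullet> (energy_matrix E B v \<theta> *v x)" for x y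
    unfolding inner_energy_matrix by (simp add: mult.commute mult.left_commute)
  ultimately show ?thesis
    by (simp add: transpose_def vec_eq_iff)
qed

lemma pos_semidef_energy_matrix_iff:
  "pos_semidef (energy_matrix E B v \<theta>) \<longleftrightarrow> (\<forall>x. 0 \<le> x \<bullet> (energy_matrix E B v \<theta> *v x))"
  by (simp add: pos_semidef_def transpose_energy_matrix)

lemma energy_matrix_apply:
  "(energy_matrix E B v \<theta> *v y) $ i = 2 * Bsum E B (Some i) * v $ i * y $ i
     - (\<Sum>k\<in>nbrs E (Some i). edge_coeff v \<theta> (Some i) k * (y $ i + phase y k))"
proof -
  let ?h = "\<lambda>a b. edge_coeff v \<theta> a b * (phase y a + phase y b)"
  have "(\<Sum>(a, b)\<in>E. edge_coeff v \<theta> a b * (phase (axis i 1) a + phase (axis i 1) b) * (phase y a + phase y b))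
      = (\<Sum>(a, b)\<in>E. phase (axis i 1) a * ?h a b + phase (axis i 1) b * ?h b a)"
    by (rule sum.cong) (auto simp: edge_coeff_sym algebra_simps)
  also have "\<dots> = (\<Sum>j\<in>UNIV. phase (axis i 1) (Some j) * (\<Sum>k\<in>nbrs E (Some j). ?h (Some j) k))"
    by (rule sum_edges_by_bus) simp
  also have "\<dots> = (\<Sum>k\<in>nbrs E (Some i). edge_coeff v \<theta> (Some i) k * (y $ i + phase y k))"
    by (simp add: axis_def if_distrib[of "\<lambda>x. x * _"] cong: if_cong)
  finally have "axis i 1 \<bullet> (energy_matrix E B v \<theta> *v y) = 2 * Bsum E B (Some i) * v $ i * y $ i
     - (\<Sum>k\<in>nbrs E (Some i). edge_coeff v \<theta> (Some i) k * (y $ i + phase y k))"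
    unfolding inner_energy_matrix
    by (simp add: axis_def if_distrib[of "\<lambda>x. _ * x"] if_distrib[of "\<lambda>x. x * _"] cong: if_cong)
  then show ?thesis by (simp add: inner_axis')
qed

text \<open>Diagonal terms do not change, and the edge terms, squares of \<open>x_i + x_k\<close>
  entering with a minus sign, can only grow in size.\<close>

lemma energy_matrix_abs:
  assumes "positive v" "\<And>i k. (i, k) \<in> E \<Longrightarrow> 0 < cos_term v \<theta> i k"
  shows "(\<chi> i. \<bar>x $ i\<bar>) \<bullet> (energy_matrix E B v \<theta> *v (\<chi> i. \<bar>x $ i\<bar>))
    \<le> x \<bullet> (energy_matrix E B v \<theta> *v x)"
proof -
  have abs: "phase (\<chi> i. \<bar>x $ i\<bar>) b = \<bar>phase x b\<bar>" for b by (cases b) auto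
  have "edge_coeff v \<theta> i k * ((phase x i + phase x k) * (phase x i + phase x k))
      \<le> edge_coeff v \<theta> i k * ((\<bar>phase x i\<bar> + \<bar>phase x k\<bar>) * (\<bar>phase x i\<bar> + \<bar>phase x k\<bar>))"
    if "(i, k) \<in> E" for i k
  proof (rule mult_left_mono)
    show "0 \<le> edge_coeff v \<theta> i k"
      using assms(2)[OF that] edge_B[OF that] volt_pos[OF assms(1)]
      by (simp add: edge_coeff_def less_imp_le)
    have "\<bar>phase x i + phase x k\<bar> * \<bar>phase x i + phase x k\<bar>
        \<le> (\<bar>phase x i\<bar> + \<bar>phase x k\<bar>) * (\<bar>phase x i\<bar> + \<bar>phase x k\<bar>)"
      by (intro mult_mono) auto
    then show "(phase x i + phase x k) * (phase x i + phase x k)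
        \<le> (\<bar>phase x i\<bar> + \<bar>phase x k\<bar>) * (\<bar>phase x i\<bar> + \<bar>phase x k\<bar>)" by simp
  qed
  then show ?thesis
    unfolding inner_energy_matrix abs by (auto simp: mult.assoc intro!: sum_mono)
qed

subsection \<open>Nondegeneracy of the greatest feasible point\<close>

text \<open>At \<open>c\<^sub>i\<^sub>k = 0\<close> the square root has infinite slope, so raising \<open>v\<^sub>i\<close> keeps feasibility.\<close>

lemma greatest_feasible_root_term_pos_bus:
  assumes "greatest_feasible p q v" "k \<in> nbrs E (Some i)"
  shows "0 < root_term E B p v (Some i) k"
proof (rule ccontr)
  assume "\<not> 0 < root_term E B p v (Some i) k"
  have v: "positive v" "sqrt_defined E B p v" "\<And>i. relaxation_lhs E B p v i \<le> q $ i"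
    and greatest: "\<And>u i. relaxation_feasible E B p q u \<Longrightarrow> u $ i \<le> v $ i"
    using assms by (auto simp: greatest_feasible_def relaxation_feasible_def)
  have zero: "volt v (Some i) * volt v k = (flow E B p (Some i) k)\<^sup>2"
    using \<open>\<not> 0 < root_term E B p v (Some i) k\<close> sqrt_definedD[OF v(2) assms(2)]
    by (auto simp: root_term_def)
  \<comment> \<open>The raised radicand is at least \<open>\<epsilon> v_k\<close>, the square of
    \<open>(B_ik / B_i) v_k\<close>. With this \<open>\<epsilon>\<close> the gain of the root, times
    \<open>B_ik\<close>, equals the growth \<open>B_i \<epsilon>\<close> of the diagonal
    term.\<close>
  define \<epsilon> where "\<epsilon> = (B (Some i) k / Bsum E B (Some i))\<^sup>2 * volt v k"
  have "0 < \<epsilon>"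
    using B_pos[OF assms(2)] Bsum_pos[of i] volt_pos[OF v(1), of k] by (simp add: \<epsilon>_def)
  define u where "u = upd v i (v $ i + \<epsilon>)"
  have le: "v $ j \<le> u $ j" for j using \<open>0 < \<epsilon>\<close> by (simp add: u_def upd_def)
  have root_mono: "root_term E B p v a b \<le> root_term E B p u a b" for a b
    by (rule root_term_mono[OF v(1) le])
  have "relaxation_lhs E B p u j \<le> q $ j" for j
  proof (cases "j = i")
    case True
    let ?N = "nbrs E (Some i)"
    have "volt u (Some i) * volt u k - (flow E B p (Some i) k)\<^sup>2 \<ge> \<epsilon> * volt v k"
      unfolding zero[symmetric]
      using mult_left_mono[OF volt_mono[OF le, of k], of "v $ i + \<epsilon>"] \<open>0 < \<epsilon>\<close> v(1)
      by (simp add: u_def upd_def positive_def algebra_simps add_nonneg_nonneg less_imp_le)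
    also have "\<epsilon> * volt v k = (B (Some i) k / Bsum E B (Some i) * volt v k)\<^sup>2"
      by (simp add: \<epsilon>_def power2_eq_square)
    finally have "B (Some i) k / Bsum E B (Some i) * volt v k \<le> root_term E B p u (Some i) k"
      unfolding root_term_def by (rule real_le_rsqrt)
    then have "B (Some i) k * (B (Some i) k / Bsum E B (Some i) * volt v k)
        \<le> B (Some i) k * root_term E B p u (Some i) k"
      using B_pos[OF assms(2)] by (intro mult_left_mono) auto
    moreover have "B (Some i) k * (B (Some i) k / Bsum E B (Some i) * volt v k) = Bsum E B (Some i) * \<epsilon>"
      using Bsum_pos[of i] by (simp add: \<epsilon>_def power2_eq_square)
    moreover have "(\<Sum>l\<in>?N - {k}. B (Some i) l * root_term E B p v (Some i) l)
        \<le> (\<Sum>l\<in>?N - {k}. B (Some i) l * root_term E B p u (Some i) l)"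
      by (intro sum_mono mult_left_mono root_mono) (use B_pos in \<open>auto simp: less_imp_le\<close>)
    moreover have "root_term E B p v (Some i) k = 0"
      by (simp add: root_term_def zero del: volt_simps)
    ultimately have "(\<Sum>l\<in>?N. B (Some i) l * root_term E B p v (Some i) l) + Bsum E B (Some i) * \<epsilon>
        \<le> (\<Sum>l\<in>?N. B (Some i) l * root_term E B p u (Some i) l)"
      using assms(2) by (subst (1 2) sum.remove[of _ k]) auto
    then show ?thesis
      using v(3)[of i] True by (simp add: relaxation_lhs_def u_def upd_def algebra_simps)
  next
    case False
    have "(\<Sum>l\<in>nbrs E (Some j). B (Some j) l * root_term E B p v (Some j) l)
        \<le> (\<Sum>l\<in>nbrs E (Some j). B (Some j) l * root_term E B p u (Some j) l)"
      by (intro sum_mono mult_left_mono root_mono) (use B_pos in \<open>auto simp: less_imp_le\<close>)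
    then show ?thesis
      using v(3)[of j] False by (simp add: relaxation_lhs_def) (simp add: u_def upd_def)
  qed
  then have "relaxation_feasible E B p q u"
    using positive_mono[OF v(1) le] sqrt_defined_mono[OF v(2,1) le]
    by (simp add: relaxation_feasible_def)
  from greatest[OF this, of i] \<open>0 < \<epsilon>\<close> show False
    by (simp add: u_def upd_def)
qed

lemma greatest_feasible_root_term_pos:
  assumes "greatest_feasible p q v" "k \<in> nbrs E i"
  shows "0 < root_term E B p v i k"
proof (cases i)
  case (Some j)
  with greatest_feasible_root_term_pos_bus assms show ?thesis by blast
next
  case None
  then obtain j where "k = Some j"
    using assms(2) no_antiparallel by (cases k) (auto simp: nbrs_def adj_def)
  with None greatest_feasible_root_term_pos_bus[OF assms(1)] assms(2) show ?thesis
    by (metis nbrs_sym root_term_sym)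
qed

text \<open>The energy matrix is twice the Jacobian of the left-hand sides of the relaxation with respect
  to \<open>log v\<close>.  If it had a negative eigenvalue, its nonnegative eigenvector would be a direction in
  which \<open>v\<close> could be increased without leaving the feasible set.\<close>

lemma greatest_feasible_pos_semidef:
  assumes "greatest_feasible p q v"
    and cos: "\<And>i k. k \<in> nbrs E i \<Longrightarrow> cos_term v \<theta> i k = root_term E B p v i k"
  shows "pos_semidef (energy_matrix E B v \<theta>)"
  unfolding pos_semidef_energy_matrix_iff
proof (rule ccontr)
  assume "\<not> (\<forall>x. 0 \<le> x \<bullet> (energy_matrix E B v \<theta> *v x))"
  then obtain x0 where x0: "x0 \<bullet> (energy_matrix E B v \<theta> *v x0) < 0" by (auto simp: not_le)
  have v: "positive v" "sqrt_defined E B p v" "\<And>i. relaxation_lhs E B p v i \<le> q $ i"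
    and greatest: "\<And>u i. relaxation_feasible E B p q u \<Longrightarrow> u $ i \<le> v $ i"
    using assms by (auto simp: greatest_feasible_def relaxation_feasible_def)
  note c_pos = greatest_feasible_root_term_pos[OF assms(1)]
  have cos_pos: "0 < cos_term v \<theta> i k" if "(i, k) \<in> E" for i k
    using c_pos cos edge_nbrs(1)[OF that] by simp
  obtain y \<mu> where "\<mu> < 0" and y: "\<And>i. 0 \<le> y $ i" "y \<noteq> 0"
    and eigen: "energy_matrix E B v \<theta> *v y = \<mu> *\<^sub>R y"
    using nonneg_eigenvector_of_negative_eigenvalue[OF transpose_energy_matrix energy_matrix_abs[OF v(1) cos_pos] x0]
    by metis
  define u where "u t = (\<chi> i. v $ i * (1 + t * y $ i))" for t
  have volt_u: "volt (u t) b = volt v b * (1 + t * phase y b)" for t b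
    by (cases b) (auto simp: u_def)
  have le: "v $ i \<le> u t $ i" if "0 \<le> t" for t i
    using that v(1) y(1) by (simp add: u_def positive_def less_imp_le algebra_simps)
  \<comment> \<open>Where \<open>y_i > 0\<close>, the derivative at 0 is
    \<open>\<mu> y_i / 2 < 0\<close>. Where \<open>y_i = 0\<close> it vanishes, but there the
    diagonal term is constant and the roots only grow.\<close>
  have "\<exists>d>0. \<forall>t. 0 < t \<longrightarrow> t < d \<longrightarrow> relaxation_lhs E B p (u t) i \<le> q $ i" for i
  proof (cases "y $ i = 0")
    case True
    have "relaxation_lhs E B p (u t) i \<le> q $ i" if "0 < t" for t
    proof -
      have "(\<Sum>l\<in>nbrs E (Some i). B (Some i) l * root_term E B p v (Some i) l)
          \<le> (\<Sum>l\<in>nbrs E (Some i). B (Some i) l * root_term E B p (u t) (Some i) l)"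
        by (intro sum_mono mult_left_mono root_term_mono v(1) le)
          (use B_pos that in \<open>auto simp: less_imp_le\<close>)
      then show ?thesis
        using v(3)[of i] True by (simp add: relaxation_lhs_def) (simp add: u_def)
    qed
    then show ?thesis by (intro exI[of _ 1]) auto
  next
    case False
    let ?D = "Bsum E B (Some i) * (v $ i * y $ i) - (\<Sum>k\<in>nbrs E (Some i).
        B (Some i) k * (volt v (Some i) * volt v k * (y $ i + phase y k) / (2 * root_term E B p v (Some i) k)))"
    have root_deriv: "((\<lambda>t. root_term E B p (u t) (Some i) k) has_real_derivative
        volt v (Some i) * volt v k * (y $ i + phase y k) / (2 * root_term E B p v (Some i) k)) (at 0)"
      if "k \<in> nbrs E (Some i)" for k
      using c_pos[OF that] unfolding root_term_def volt_u
      by (auto intro!: derivative_eq_intros simp: field_simps)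
    have "((\<lambda>t. u t $ i) has_real_derivative v $ i * y $ i) (at 0)"
      by (auto intro!: derivative_eq_intros simp: u_def)
    then have deriv: "((\<lambda>t. relaxation_lhs E B p (u t) i) has_real_derivative ?D) (at 0)"
      unfolding relaxation_lhs_def
      by (intro DERIV_diff DERIV_sum DERIV_cmult root_deriv)
    have "2 * ?D = (energy_matrix E B v \<theta> *v y) $ i"
      unfolding energy_matrix_apply
      by (simp add: edge_coeff_def cos sum_distrib_left right_diff_distrib) (simp add: field_simps)
    moreover have "(energy_matrix E B v \<theta> *v y) $ i < 0"
      using \<open>\<mu> < 0\<close> False y(1)[of i] by (simp add: eigen mult_neg_pos)
    moreover have "a < 0" if "2 * a = b" "b < 0" for a b :: real using that by linarith
    ultimately have "?D < 0" by blast
    then obtain d where "0 < d" "\<And>h. 0 < h \<Longrightarrow> h < d \<Longrightarrow>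
        relaxation_lhs E B p (u h) i < relaxation_lhs E B p (u 0) i"
      using has_real_derivative_neg_dec_right[OF deriv] by force
    moreover have "u 0 = v" by (simp add: u_def vec_eq_iff)
    ultimately show ?thesis
      using v(3)[of i] by (intro exI[of _ d]) force
  qed
  then obtain d where d: "\<And>i. 0 < d i"
    "\<And>i t. 0 < t \<Longrightarrow> t < d i \<Longrightarrow> relaxation_lhs E B p (u t) i \<le> q $ i" by metis
  define t where "t = Min (range d) / 2"
  have "0 < Min (range d)" using d(1) by (subst Min_gr_iff) auto
  moreover have "Min (range d) \<le> d i" for i by (rule Min_le) auto
  ultimately have t: "0 < t" "t < d i" for i
    unfolding t_def by (simp, smt (verit) field_sum_of_halves)
  then have "0 \<le> t" by simp
  have "relaxation_feasible E B p q (u t)"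
    using positive_mono[OF v(1) le[OF \<open>0 \<le> t\<close>]] sqrt_defined_mono[OF v(2,1) le[OF \<open>0 \<le> t\<close>]] d(2) t
    by (simp add: relaxation_feasible_def)
  moreover obtain i where "0 < y $ i"
    using y by (metis order_less_le vec_eq_iff zero_index)
  then have "v $ i < u t $ i"
    using v(1) t(1) by (simp add: u_def positive_def)
  ultimately show False
    using greatest[of "u t" i] by simp
qed

end

text \<open>Voltages are parametrized by their logarithms, in which the stationarity equations and the
  convexity of the energy are formulated.\<close>

definition exp_vec :: "real ^ 'n \<Rightarrow> real ^ 'n" where
  "exp_vec r = (\<chi> i. exp (r $ i))"

lemma positive_exp_vec: "positive (exp_vec r)"
  by (simp add: positive_def exp_vec_def)

lemma volt_exp_vec: "volt (exp_vec r) b = exp (phase r b)"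
  by (cases b) (auto simp: exp_vec_def)

lemma sqrt_volt_exp_vec: "sqrt (volt (exp_vec r) i * volt (exp_vec r) k) = exp ((phase r i + phase r k) / 2)"
proof (rule real_sqrt_unique)
  show "(exp ((phase r i + phase r k) / 2))\<^sup>2 = volt (exp_vec r) i * volt (exp_vec r) k"
    by (simp add: volt_exp_vec exp_add[symmetric] power2_eq_square)
qed simp

lemma positive_imp_exp_vec:
  assumes "positive v"
  obtains r where "v = exp_vec r"
  by (rule that[of "\<chi> i. ln (v $ i)"]) (use assms in \<open>simp add: exp_vec_def positive_def vec_eq_iff\<close>)

lemma upd_eq_axis: "upd r i t = r + (t - r $ i) *\<^sub>R axis i 1"
  by (simp add: upd_def vec_eq_iff axis_def)

lemma upd_exp_vec: "upd (exp_vec r) i (exp t) = exp_vec (upd r i t)"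
  by (simp add: upd_def exp_vec_def vec_eq_iff)

context radial_network begin

subsection \<open>Derivatives of the energy along lines\<close>

lemma energy_exp_vec:
  "energy E B p q (exp_vec r) \<theta> = (\<Sum>(i, k)\<in>E. B i k * (exp (phase r i) + exp (phase r k)
       - 2 * exp ((phase r i + phase r k) / 2) * cos (phase \<theta> i - phase \<theta> k)))
     - 2 * (\<Sum>i\<in>UNIV. p $ i * \<theta> $ i) - (\<Sum>i\<in>UNIV. q $ i * r $ i)"
  unfolding energy_def sqrt_volt_exp_vec unfolding volt_exp_vec by (simp add: exp_vec_def)

definition energy_deriv where
  "energy_deriv p q r \<theta> \<delta> \<eta> = (\<Sum>(i, k)\<in>E. B i k * (exp (phase r i) * phase \<delta> i + exp (phase r k) * phase \<delta> k
       - exp ((phase r i + phase r k) / 2) * ((phase \<delta> i + phase \<delta> k) * cos (phase \<theta> i - phase \<theta> k)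
           - 2 * sin (phase \<theta> i - phase \<theta> k) * (phase \<eta> i - phase \<eta> k))))
     - 2 * (\<Sum>i\<in>UNIV. p $ i * \<eta> $ i) - (\<Sum>i\<in>UNIV. q $ i * \<delta> $ i)"

definition energy_deriv2 where
  "energy_deriv2 r \<theta> \<delta> \<eta> = (\<Sum>(i, k)\<in>E. B i k * (exp (phase r i) * (phase \<delta> i)\<^sup>2 + exp (phase r k) * (phase \<delta> k)\<^sup>2
       - exp ((phase r i + phase r k) / 2) * ((phase \<delta> i + phase \<delta> k)\<^sup>2 / 2 * cos (phase \<theta> i - phase \<theta> k)
           - 2 * (phase \<delta> i + phase \<delta> k) * sin (phase \<theta> i - phase \<theta> k) * (phase \<eta> i - phase \<eta> k)
           - 2 * cos (phase \<theta> i - phase \<theta> k) * (phase \<eta> i - phase \<eta> k)\<^sup>2)))"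

lemma has_derivative_energy:
  "((\<lambda>t. energy E B p q (exp_vec (r + t *\<^sub>R \<delta>)) (\<theta> + t *\<^sub>R \<eta>)) has_real_derivative
     energy_deriv p q (r + t *\<^sub>R \<delta>) (\<theta> + t *\<^sub>R \<eta>) \<delta> \<eta>) (at t)"
proof -
  have edge: "((\<lambda>t. exp (phase (r + t *\<^sub>R \<delta>) i) + exp (phase (r + t *\<^sub>R \<delta>) k)
      - 2 * exp ((phase (r + t *\<^sub>R \<delta>) i + phase (r + t *\<^sub>R \<delta>) k) / 2)
        * cos (phase (\<theta> + t *\<^sub>R \<eta>) i - phase (\<theta> + t *\<^sub>R \<eta>) k)) has_real_derivative
      exp (phase (r + t *\<^sub>R \<delta>) i) * phase \<delta> i + exp (phase (r + t *\<^sub>R \<delta>) k) * phase \<delta> k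
       - exp ((phase (r + t *\<^sub>R \<delta>) i + phase (r + t *\<^sub>R \<delta>) k) / 2)
        * ((phase \<delta> i + phase \<delta> k) * cos (phase (\<theta> + t *\<^sub>R \<eta>) i - phase (\<theta> + t *\<^sub>R \<eta>) k)
           - 2 * sin (phase (\<theta> + t *\<^sub>R \<eta>) i - phase (\<theta> + t *\<^sub>R \<eta>) k) * (phase \<eta> i - phase \<eta> k))) (at t)" for i k
    unfolding phase_add phase_scaleR
    by (rule derivative_eq_intros refl | simp)+ (simp add: field_simps)
  have linear: "((\<lambda>t. a $ i * (x + t *\<^sub>R y) $ i) has_real_derivative a $ i * y $ i) (at t)"
    for a x y :: "real ^ 'n" and i
    by (auto intro!: derivative_eq_intros)
  show ?thesis
    unfolding energy_exp_vec energy_deriv_def case_prod_unfold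
    by (intro edge linear DERIV_diff DERIV_sum DERIV_cmult)
qed

lemma has_derivative_energy_deriv:
  "((\<lambda>t. energy_deriv p q (r + t *\<^sub>R \<delta>) (\<theta> + t *\<^sub>R \<eta>) \<delta> \<eta>) has_real_derivative
     energy_deriv2 (r + t *\<^sub>R \<delta>) (\<theta> + t *\<^sub>R \<eta>) \<delta> \<eta>) (at t)"
proof -
  have edge: "((\<lambda>t. exp (phase (r + t *\<^sub>R \<delta>) i) * phase \<delta> i + exp (phase (r + t *\<^sub>R \<delta>) k) * phase \<delta> k
       - exp ((phase (r + t *\<^sub>R \<delta>) i + phase (r + t *\<^sub>R \<delta>) k) / 2)
        * ((phase \<delta> i + phase \<delta> k) * cos (phase (\<theta> + t *\<^sub>R \<eta>) i - phase (\<theta> + t *\<^sub>R \<eta>) k)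
           - 2 * sin (phase (\<theta> + t *\<^sub>R \<eta>) i - phase (\<theta> + t *\<^sub>R \<eta>) k) * (phase \<eta> i - phase \<eta> k)))
     has_real_derivative
      exp (phase (r + t *\<^sub>R \<delta>) i) * (phase \<delta> i)\<^sup>2 + exp (phase (r + t *\<^sub>R \<delta>) k) * (phase \<delta> k)\<^sup>2
       - exp ((phase (r + t *\<^sub>R \<delta>) i + phase (r + t *\<^sub>R \<delta>) k) / 2)
        * ((phase \<delta> i + phase \<delta> k)\<^sup>2 / 2 * cos (phase (\<theta> + t *\<^sub>R \<eta>) i - phase (\<theta> + t *\<^sub>R \<eta>) k)
           - 2 * (phase \<delta> i + phase \<delta> k) * sin (phase (\<theta> + t *\<^sub>R \<eta>) i - phase (\<theta> + t *\<^sub>R \<eta>) k) * (phase \<eta> i - phase \<eta> k)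
           - 2 * cos (phase (\<theta> + t *\<^sub>R \<eta>) i - phase (\<theta> + t *\<^sub>R \<eta>) k) * (phase \<eta> i - phase \<eta> k)\<^sup>2)) (at t)" for i k
    unfolding phase_add phase_scaleR
    by (rule derivative_eq_intros refl | simp)+ (simp add: field_simps power2_eq_square)
  have "((\<lambda>t. energy_deriv p q (r + t *\<^sub>R \<delta>) (\<theta> + t *\<^sub>R \<eta>) \<delta> \<eta>) has_real_derivative
     energy_deriv2 (r + t *\<^sub>R \<delta>) (\<theta> + t *\<^sub>R \<eta>) \<delta> \<eta> - 0 - 0) (at t)"
    unfolding energy_deriv_def energy_deriv2_def case_prod_unfold
    by (intro edge DERIV_const DERIV_diff DERIV_sum DERIV_cmult)
  then show ?thesis by simp
qed

text \<open>Summation by parts pairs the direction \<open>\<delta>\<close> of \<open>log v\<close>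
  with the residuals of the \<open>q\<close> equations and the direction \<open>\<eta>\<close> of
  \<open>\<theta>\<close> with those of the \<open>p\<close> equations, using that the cosine terms
  are symmetric and the sine terms antisymmetric.\<close>

lemma energy_deriv_by_bus:
  "energy_deriv p q r \<theta> \<delta> \<eta>
   = (\<Sum>i\<in>UNIV. \<delta> $ i * (Bsum E B (Some i) * exp (r $ i)
        - (\<Sum>k\<in>nbrs E (Some i). B (Some i) k * cos_term (exp_vec r) \<theta> (Some i) k) - q $ i))
   + 2 * (\<Sum>i\<in>UNIV. \<eta> $ i *
        ((\<Sum>k\<in>nbrs E (Some i). B (Some i) k * sin_term (exp_vec r) \<theta> (Some i) k) - p $ i))"
proof -
  let ?C = "cos_term (exp_vec r) \<theta>" and ?S = "sin_term (exp_vec r) \<theta>"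
  have 1: "(\<Sum>(i, k)\<in>E. phase \<delta> i * (B i k * exp (phase r i) - B i k * ?C i k)
        + phase \<delta> k * (B k i * exp (phase r k) - B k i * ?C k i))
      = (\<Sum>i\<in>UNIV. \<delta> $ i * (Bsum E B (Some i) * exp (r $ i)
        - (\<Sum>k\<in>nbrs E (Some i). B (Some i) k * ?C (Some i) k)))"
    by (subst sum_edges_by_bus) (simp_all add: Bsum_def sum_distrib_right sum_subtractf)
  have 2: "(\<Sum>(i, k)\<in>E. phase \<eta> i * (B i k * ?S i k) + phase \<eta> k * (B k i * ?S k i))
      = (\<Sum>i\<in>UNIV. \<eta> $ i * (\<Sum>k\<in>nbrs E (Some i). B (Some i) k * ?S (Some i) k))"
    by (subst sum_edges_by_bus) simp_all
  have "(\<Sum>(i, k)\<in>E. B i k * (exp (phase r i) * phase \<delta> i + exp (phase r k) * phase \<delta> k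
       - exp ((phase r i + phase r k) / 2) * ((phase \<delta> i + phase \<delta> k) * cos (phase \<theta> i - phase \<theta> k)
           - 2 * sin (phase \<theta> i - phase \<theta> k) * (phase \<eta> i - phase \<eta> k))))
      = (\<Sum>(i, k)\<in>E. phase \<delta> i * (B i k * exp (phase r i) - B i k * ?C i k)
        + phase \<delta> k * (B k i * exp (phase r k) - B k i * ?C k i))
      + 2 * (\<Sum>(i, k)\<in>E. phase \<eta> i * (B i k * ?S i k) + phase \<eta> k * (B k i * ?S k i))"
    unfolding sum_distrib_left sum.distrib[symmetric]
  proof (rule sum.cong[OF refl], clarify)
    fix i k assume e: "(i, k) \<in> E"
    show "B i k * (exp (phase r i) * phase \<delta> i + exp (phase r k) * phase \<delta> k
       - exp ((phase r i + phase r k) / 2) * ((phase \<delta> i + phase \<delta> k) * cos (phase \<theta> i - phase \<theta> k)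
           - 2 * sin (phase \<theta> i - phase \<theta> k) * (phase \<eta> i - phase \<eta> k)))
      = phase \<delta> i * (B i k * exp (phase r i) - B i k * ?C i k)
        + phase \<delta> k * (B k i * exp (phase r k) - B k i * ?C k i)
        + 2 * (phase \<eta> i * (B i k * ?S i k) + phase \<eta> k * (B k i * ?S k i))"
      unfolding cos_term_sym[of _ _ k i] sin_term_antisym[of _ _ k i] edge_B(2)[OF e]
      unfolding cos_term_def sin_term_def sqrt_volt_exp_vec by (simp add: algebra_simps)
  qed
  then show ?thesis
    unfolding energy_deriv_def 1 2
    by (simp add: right_diff_distrib sum_subtractf mult.commute)
qed

text \<open>The partial derivatives are directional derivatives along basis vectors in
  \<open>(log v, \<theta>)\<close>, which single out one residual each.\<close>

lemma energy_stationary_iff: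
  assumes "positive v"
  shows "energy_stationary E B p q v \<theta> \<longleftrightarrow>
     (\<forall>i. Bsum E B (Some i) * v $ i
        - (\<Sum>k\<in>nbrs E (Some i). B (Some i) k * cos_term v \<theta> (Some i) k) = q $ i) \<and>
     (\<forall>i. (\<Sum>k\<in>nbrs E (Some i). B (Some i) k * sin_term v \<theta> (Some i) k) = p $ i)"
proof -
  obtain r where v: "v = exp_vec r" using positive_imp_exp_vec[OF assms] .
  have shift: "((\<lambda>t. f (t - a)) has_real_derivative D) (at a)"
    if "(f has_real_derivative D) (at 0)" for f :: "real \<Rightarrow> real" and a D
    using that DERIV_shift[of f D a "- a"] by simp
  have unique: "(f has_real_derivative 0) (at a) \<longleftrightarrow> D = 0"
    if "(f has_real_derivative D) (at a)" for f :: "real \<Rightarrow> real" and a D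
    using that DERIV_unique by blast
  have "((\<lambda>t. energy E B p q (upd v i (exp t)) \<theta>) has_real_derivative
      energy_deriv p q r \<theta> (axis i 1) 0) (at (ln (v $ i)))" for i
    using shift[OF has_derivative_energy[of p q r "axis i 1" \<theta> 0 0], of "r $ i"]
    unfolding v upd_exp_vec unfolding upd_eq_axis by (simp add: exp_vec_def)
  from unique[OF this]
  have "((\<lambda>t. energy E B p q (upd v i (exp t)) \<theta>) has_real_derivative 0) (at (ln (v $ i))) \<longleftrightarrow>
     Bsum E B (Some i) * v $ i
        - (\<Sum>k\<in>nbrs E (Some i). B (Some i) k * cos_term v \<theta> (Some i) k) = q $ i" for i
    by (simp add: energy_deriv_by_bus v axis_def if_distrib[of "\<lambda>x. x * _"] cong: if_cong)
      (simp add: exp_vec_def)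
  moreover have "((\<lambda>t. energy E B p q v (upd \<theta> i t)) has_real_derivative
      energy_deriv p q r \<theta> 0 (axis i 1)) (at (\<theta> $ i))" for i
    using shift[OF has_derivative_energy[of p q r 0 \<theta> "axis i 1" 0], of "\<theta> $ i"]
    by (simp add: v upd_eq_axis)
  from unique[OF this]
  have "((\<lambda>t. energy E B p q v (upd \<theta> i t)) has_real_derivative 0) (at (\<theta> $ i)) \<longleftrightarrow>
     (\<Sum>k\<in>nbrs E (Some i). B (Some i) k * sin_term v \<theta> (Some i) k) = p $ i" for i
    by (simp add: energy_deriv_by_bus v axis_def if_distrib[of "\<lambda>x. x * _"] cong: if_cong)
  ultimately show ?thesis by (simp add: energy_stationary_def)
qed

end

section \<open>Convexity of \<open>exp a / cos x\<close>\<close>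

lemma cos_pos_imp_abs_less:
  assumes "\<bar>x\<bar> \<le> pi" "0 < cos x"
  shows "\<bar>x\<bar> < pi / 2"
proof (rule ccontr)
  assume "\<not> \<bar>x\<bar> < pi / 2"
  then have "cos \<bar>x\<bar> \<le> cos (pi / 2)"
    using assms(1) by (intro cos_monotone_0_pi_le) auto
  with assms(2) show False by simp
qed

lemma convex_on_minus_ln_cos: "convex_on {- (pi/2)<..<pi/2} (\<lambda>x. - ln (cos x))"
proof (rule f''_ge0_imp_convex)
  fix x :: real assume "x \<in> {- (pi/2)<..<pi/2}"
  then have c: "0 < cos x" using cos_gt_zero_pi[of x] by simp
  show "((\<lambda>x. - ln (cos x)) has_real_derivative tan x) (at x)"
    using c by (auto intro!: derivative_eq_intros simp: tan_def)
  show "(tan has_real_derivative inverse ((cos x)\<^sup>2)) (at x)"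
    using c by (intro DERIV_tan) simp
  show "0 \<le> inverse ((cos x)\<^sup>2)" by simp
qed auto

text \<open>The quotient is \<open>exp (a - ln (cos x))\<close>, the increasing convex exponential
  of a convex function.\<close>

lemma exp_div_cos_convex:
  assumes "0 \<le> t" "t \<le> 1" "\<bar>x\<bar> < pi / 2" "\<bar>y\<bar> < pi / 2"
  shows "exp ((1 - t) * a + t * b) / cos ((1 - t) * x + t * y)
    \<le> (1 - t) * (exp a / cos x) + t * (exp b / cos y)"
proof -
  let ?I = "{- (pi/2)<..<pi/2}" and ?z = "(1 - t) * x + t * y"
  have I: "x \<in> ?I" "y \<in> ?I" using assms by auto
  then have "?z \<in> ?I"
    using convexD[of ?I x y "1 - t" t] assms(1,2) by simp
  with I have pos: "0 < cos x" "0 < cos y" "0 < cos ?z"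
    using cos_gt_zero_pi by auto
  have e: "exp u / c = exp (u + - ln c)" if "0 < c" for u c :: real
    using that by (simp add: exp_diff)
  have "- ln (cos ?z) \<le> (1 - t) * - ln (cos x) + t * - ln (cos y)"
    using convex_onD[OF convex_on_minus_ln_cos assms(1,2) I] by simp
  then have "exp ((1 - t) * a + t * b + - ln (cos ?z))
      \<le> exp ((1 - t) * (a + - ln (cos x)) + t * (b + - ln (cos y)))"
    by (simp add: algebra_simps)
  also have "\<dots> \<le> (1 - t) * exp (a + - ln (cos x)) + t * exp (b + - ln (cos y))"
    using convex_onD[OF exp_convex assms(1,2), of "a + - ln (cos x)" "b + - ln (cos y)"] by simp
  finally show ?thesis
    unfolding e[OF pos(1)] e[OF pos(2)] e[OF pos(3)] .
qed

context radial_network begin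

subsection \<open>Convexity of the energy problem\<close>

lemma energy_feasible_angle:
  assumes "energy_feasible E B v \<theta>" "(i, k) \<in> E"
  shows "\<bar>phase \<theta> i - phase \<theta> k\<bar> < pi / 2" "0 < cos (phase \<theta> i - phase \<theta> k)"
proof -
  have "positive v" "\<bar>phase \<theta> i - phase \<theta> k\<bar> \<le> pi" "0 < cos_term v \<theta> i k"
    using assms by (auto simp: energy_feasible_def)
  moreover from this have "0 < sqrt (volt v i * volt v k)"
    using volt_pos[of v i] volt_pos[of v k] by simp
  ultimately show "0 < cos (phase \<theta> i - phase \<theta> k)"
    unfolding cos_term_def by (blast intro: zero_less_mult_pos)
  then show "\<bar>phase \<theta> i - phase \<theta> k\<bar> < pi / 2"
    using \<open>\<bar>phase \<theta> i - phase \<theta> k\<bar> \<le> pi\<close> by (rule cos_pos_imp_abs_less[rotated])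
qed

text \<open>The quadratic form of the energy matrix after the congruence \<open>x\<^sub>i = y\<^sub>i / sqrt v\<^sub>i\<close>.  In this form
  it is, for nonnegative \<open>y\<close>, a concave function of \<open>(log v, \<theta>)\<close>.\<close>

definition scaled_form where
  "scaled_form r \<theta> y = (\<Sum>i\<in>UNIV. 2 * Bsum E B (Some i) * (y $ i)\<^sup>2)
     - (\<Sum>(i, k)\<in>E. B i k * ((phase y i)\<^sup>2 * (exp ((phase r k - phase r i) / 2) / cos (phase \<theta> i - phase \<theta> k))
         + 2 * phase y i * phase y k * (exp 0 / cos (phase \<theta> i - phase \<theta> k))
         + (phase y k)\<^sup>2 * (exp ((phase r i - phase r k) / 2) / cos (phase \<theta> i - phase \<theta> k))))"

text \<open>The scaling cancels the voltages on the diagonal and leaves on the edges only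
  exponentials of differences of \<open>r\<close>, which are affine along a segment.\<close>

lemma scaled_form_eq:
  "scaled_form r \<theta> y = (\<chi> i. y $ i * exp (- r $ i / 2))
     \<bullet> (energy_matrix E B (exp_vec r) \<theta> *v (\<chi> i. y $ i * exp (- r $ i / 2)))"
proof -
  have ph: "phase (\<chi> i. y $ i * exp (- r $ i / 2)) b = phase y b * exp (- phase r b / 2)" for b
    by (cases b) auto
  have diag: "exp s * (a * exp (- s / 2)) * (a * exp (- s / 2)) = a\<^sup>2" for s a :: real
  proof -
    have "exp s * (exp (- s / 2) * exp (- s / 2)) = 1"
      unfolding exp_add[symmetric] by simp
    then show ?thesis by (simp add: power2_eq_square algebra_simps)
  qed
  have edge: "exp s * exp u / (exp ((s + u) / 2) * c)
      * ((a * exp (- s / 2) + b * exp (- u / 2)) * (a * exp (- s / 2) + b * exp (- u / 2)))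
      = a\<^sup>2 * (exp ((u - s) / 2) / c) + 2 * a * b * (exp 0 / c) + b\<^sup>2 * (exp ((s - u) / 2) / c)"
    for s u a b c :: real
  proof -
    \<comment> \<open>All exponentials are monomials in these two, so the identity becomes one of
      rational functions.\<close>
    define \<alpha> \<beta> where "\<alpha> = exp (s / 2)" and "\<beta> = exp (u / 2)"
    have e: "exp s = \<alpha> * \<alpha>" "exp u = \<beta> * \<beta>" "exp ((s + u) / 2) = \<alpha> * \<beta>"
      "exp (- s / 2) = 1 / \<alpha>" "exp (- u / 2) = 1 / \<beta>"
      "exp ((u - s) / 2) = \<beta> / \<alpha>" "exp ((s - u) / 2) = \<alpha> / \<beta>"
      unfolding \<alpha>_def \<beta>_def
      by (simp_all add: exp_add[symmetric] exp_diff[symmetric] exp_minus field_simps)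
    have "\<alpha> \<noteq> 0" "\<beta> \<noteq> 0" by (auto simp: \<alpha>_def \<beta>_def)
    then show ?thesis
      unfolding e by (cases "c = 0") (simp_all add: field_simps power2_eq_square)
  qed
  have diag': "2 * Bsum E B (Some i) * exp_vec r $ i * (y $ i * exp (- r $ i / 2)) * (y $ i * exp (- r $ i / 2))
      = 2 * Bsum E B (Some i) * (y $ i)\<^sup>2" for i
    using diag[of "r $ i" "y $ i"] by (simp add: exp_vec_def mult.assoc)
  have edge': "edge_coeff (exp_vec r) \<theta> i k
      * (phase y i * exp (- phase r i / 2) + phase y k * exp (- phase r k / 2))
      * (phase y i * exp (- phase r i / 2) + phase y k * exp (- phase r k / 2))
      = B i k * ((phase y i)\<^sup>2 * (exp ((phase r k - phase r i) / 2) / cos (phase \<theta> i - phase \<theta> k))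
         + 2 * phase y i * phase y k * (exp 0 / cos (phase \<theta> i - phase \<theta> k))
         + (phase y k)\<^sup>2 * (exp ((phase r i - phase r k) / 2) / cos (phase \<theta> i - phase \<theta> k)))" for i k
    unfolding edge[symmetric] edge_coeff_def cos_term_def sqrt_volt_exp_vec
    by (simp add: volt_exp_vec mult.assoc)
  show ?thesis
    by (simp only: inner_energy_matrix ph vec_lambda_beta diag' edge' scaled_form_def)
qed

text \<open>By \<open>energy_matrix_abs\<close>, semidefiniteness needs testing only on nonnegative
  vectors. There every coefficient, including the cross term \<open>2 y_i y_k\<close>, is
  nonnegative, so convexity of \<open>exp a / cos x\<close> makes \<open>scaled_form\<close> concave
  along the segment.\<close>

lemma energy_feasible_segment:
  assumes f0: "energy_feasible E B (exp_vec r0) \<theta>0" and f1: "energy_feasible E B (exp_vec r1) \<theta>1"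
    and t: "0 \<le> t" "t \<le> 1"
  shows "energy_feasible E B (exp_vec (r0 + t *\<^sub>R (r1 - r0))) (\<theta>0 + t *\<^sub>R (\<theta>1 - \<theta>0))"
proof -
  define r \<theta> where "r = r0 + t *\<^sub>R (r1 - r0)" and "\<theta> = \<theta>0 + t *\<^sub>R (\<theta>1 - \<theta>0)"
  have phase_r: "phase r b = (1 - t) * phase r0 b + t * phase r1 b" for b
    by (simp add: r_def phase_add phase_scaleR phase_diff algebra_simps)
  have phase_\<theta>: "phase \<theta> i - phase \<theta> k
      = (1 - t) * (phase \<theta>0 i - phase \<theta>0 k) + t * (phase \<theta>1 i - phase \<theta>1 k)" for i k
    by (simp add: \<theta>_def phase_add phase_scaleR phase_diff algebra_simps)
  have angle: "\<bar>phase \<theta> i - phase \<theta> k\<bar> < pi / 2" if "(i, k) \<in> E" for i k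
  proof -
    have "(1 - t) *\<^sub>R (phase \<theta>0 i - phase \<theta>0 k) + t *\<^sub>R (phase \<theta>1 i - phase \<theta>1 k) \<in> {- (pi/2)<..<pi/2}"
      using energy_feasible_angle(1)[OF f0 that] energy_feasible_angle(1)[OF f1 that] t
      by (intro convexD) (simp_all only: convex_real_interval greaterThanLessThan_iff, linarith+)
    then show ?thesis
      by (simp only: phase_\<theta> greaterThanLessThan_iff real_scaleR_def) linarith
  qed
  then have cos: "0 < cos (phase \<theta> i - phase \<theta> k)" if "(i, k) \<in> E" for i k
    using angle[OF that] by (intro cos_gt_zero_pi) linarith+
  have cos_term: "0 < cos_term (exp_vec r) \<theta> i k" if "(i, k) \<in> E" for i k
    using cos[OF that] by (simp add: cos_term_def sqrt_volt_exp_vec)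
  have scaled: "0 \<le> scaled_form r \<theta> y" if y: "\<And>i. 0 \<le> y $ i" for y
  proof -
    have y': "0 \<le> phase y b" for b using y by (cases b) auto
    let ?G = "\<lambda>r \<theta> i k. (phase y i)\<^sup>2 * (exp ((phase r k - phase r i) / 2) / cos (phase \<theta> i - phase \<theta> k))
         + 2 * phase y i * phase y k * (exp 0 / cos (phase \<theta> i - phase \<theta> k))
         + (phase y k)\<^sup>2 * (exp ((phase r i - phase r k) / 2) / cos (phase \<theta> i - phase \<theta> k))"
    have "B i k * ?G r \<theta> i k \<le> (1 - t) * (B i k * ?G r0 \<theta>0 i k) + t * (B i k * ?G r1 \<theta>1 i k)"
      if e: "(i, k) \<in> E" for i k
    proof -
      have conv: "exp ((1 - t) * a + t * b) / cos (phase \<theta> i - phase \<theta> k)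
          \<le> (1 - t) * (exp a / cos (phase \<theta>0 i - phase \<theta>0 k)) + t * (exp b / cos (phase \<theta>1 i - phase \<theta>1 k))"
        for a b
        unfolding phase_\<theta>
        by (rule exp_div_cos_convex[OF t energy_feasible_angle(1)[OF f0 e] energy_feasible_angle(1)[OF f1 e]])
      have split: "(phase r k - phase r i) / 2
           = (1 - t) * ((phase r0 k - phase r0 i) / 2) + t * ((phase r1 k - phase r1 i) / 2)" for i k
        by (simp add: phase_r field_simps)
      have "?G r \<theta> i k \<le>
          (phase y i)\<^sup>2 * ((1 - t) * (exp ((phase r0 k - phase r0 i) / 2) / cos (phase \<theta>0 i - phase \<theta>0 k))
            + t * (exp ((phase r1 k - phase r1 i) / 2) / cos (phase \<theta>1 i - phase \<theta>1 k)))
          + 2 * phase y i * phase y k * ((1 - t) * (exp 0 / cos (phase \<theta>0 i - phase \<theta>0 k))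
            + t * (exp 0 / cos (phase \<theta>1 i - phase \<theta>1 k)))
          + (phase y k)\<^sup>2 * ((1 - t) * (exp ((phase r0 i - phase r0 k) / 2) / cos (phase \<theta>0 i - phase \<theta>0 k))
            + t * (exp ((phase r1 i - phase r1 k) / 2) / cos (phase \<theta>1 i - phase \<theta>1 k)))"
        unfolding split
        by (intro add_mono mult_left_mono conv) (use conv[of 0 0] y' in auto)
      also have "\<dots> = (1 - t) * ?G r0 \<theta>0 i k + t * ?G r1 \<theta>1 i k"
        by (simp only: distrib_left mult_ac add_ac)
      finally have "B i k * ?G r \<theta> i k \<le> B i k * ((1 - t) * ?G r0 \<theta>0 i k + t * ?G r1 \<theta>1 i k)"
        by (rule mult_left_mono) (use edge_B(1)[OF e] in simp)
      then show ?thesis by (simp only: distrib_left mult.left_commute)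
    qed
    then have "(\<Sum>(i, k)\<in>E. B i k * ?G r \<theta> i k)
        \<le> (\<Sum>(i, k)\<in>E. (1 - t) * (B i k * ?G r0 \<theta>0 i k) + t * (B i k * ?G r1 \<theta>1 i k))"
      by (intro sum_mono) auto
    also have "\<dots> = (1 - t) * (\<Sum>(i, k)\<in>E. B i k * ?G r0 \<theta>0 i k) + t * (\<Sum>(i, k)\<in>E. B i k * ?G r1 \<theta>1 i k)"
      by (simp only: case_prod_unfold sum.distrib sum_distrib_left)
    finally have "(1 - t) * scaled_form r0 \<theta>0 y + t * scaled_form r1 \<theta>1 y \<le> scaled_form r \<theta> y"
      unfolding scaled_form_def by (simp only: right_diff_distrib) (simp add: algebra_simps)
    moreover have "0 \<le> scaled_form r0 \<theta>0 y" "0 \<le> scaled_form r1 \<theta>1 y"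
      unfolding scaled_form_eq using f0 f1 by (auto simp: energy_feasible_def pos_semidef_def)
    ultimately show ?thesis
      using t by (smt (verit) mult_nonneg_nonneg)
  qed
  have "0 \<le> x \<bullet> (energy_matrix E B (exp_vec r) \<theta> *v x)" for x
  proof -
    define y where "y = (\<chi> i. \<bar>x $ i\<bar> * exp (r $ i / 2))"
    have "(\<chi> i. y $ i * exp (- r $ i / 2)) = (\<chi> i. \<bar>x $ i\<bar>)"
      by (simp add: y_def vec_eq_iff mult.assoc exp_add[symmetric])
    then have "0 \<le> (\<chi> i. \<bar>x $ i\<bar>) \<bullet> (energy_matrix E B (exp_vec r) \<theta> *v (\<chi> i. \<bar>x $ i\<bar>))"
      using scaled[of y] by (simp add: scaled_form_eq) (simp add: y_def)
    also have "\<dots> \<le> x \<bullet> (energy_matrix E B (exp_vec r) \<theta> *v x)"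
      by (rule energy_matrix_abs[OF positive_exp_vec cos_term])
    finally show ?thesis .
  qed
  moreover have "\<bar>phase \<theta> i - phase \<theta> k\<bar> \<le> pi" if "(i, k) \<in> E" for i k
    using angle[OF that] pi_gt_zero by linarith
  ultimately show ?thesis
    unfolding energy_feasible_def pos_semidef_energy_matrix_iff r_def[symmetric] \<theta>_def[symmetric]
    using cos_term positive_exp_vec by auto
qed

text \<open>The energy matrix is, up to a factor, the Schur complement of the phase block in the Hessian
  of the energy.\<close>

lemma energy_deriv2_nonneg:
  assumes "energy_feasible E B (exp_vec r) \<theta>"
  shows "0 \<le> energy_deriv2 r \<theta> \<delta> \<eta>"
proof -
  let ?L = "\<lambda>i k. exp (phase r i) * (phase \<delta> i)\<^sup>2 + exp (phase r k) * (phase \<delta> k)\<^sup>2"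
  \<comment> \<open>Completing the square in the phase increment \<open>n\<close>: the difference of
    the sides is \<open>u (m s + 2 c n)^2 / (2 c)\<close>, so the right side is maximal over
    \<open>n\<close> with value the left side.\<close>
  have schur: "u / 2 * (m\<^sup>2 / c) \<ge> u * (m\<^sup>2 / 2 * c - 2 * m * s * n - 2 * c * n\<^sup>2)"
    if "0 < c" "s\<^sup>2 + c\<^sup>2 = 1" "0 < u" for u m c s n :: real
  proof -
    have "m\<^sup>2 / (2 * c) - (m\<^sup>2 / 2 * c - 2 * m * s * n - 2 * c * n\<^sup>2) = (m * s + 2 * c * n)\<^sup>2 / (2 * c)"
    proof -
      have "(m * s + 2 * c * n)\<^sup>2 = m\<^sup>2 * (1 - c\<^sup>2) + 4 * m * s * c * n + 4 * c\<^sup>2 * n\<^sup>2"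
        using that(2) by (simp add: power2_eq_square algebra_simps flip: that(2))
      then show ?thesis using that(1) by (simp add: field_simps power2_eq_square)
    qed
    moreover have "0 \<le> (m * s + 2 * c * n)\<^sup>2 / (2 * c)" using that(1) by simp
    ultimately have "m\<^sup>2 / 2 * c - 2 * m * s * n - 2 * c * n\<^sup>2 \<le> m\<^sup>2 / (2 * c)" by linarith
    then have "u * (m\<^sup>2 / 2 * c - 2 * m * s * n - 2 * c * n\<^sup>2) \<le> u * (m\<^sup>2 / (2 * c))"
      using that(3) by (intro mult_left_mono) auto
    then show ?thesis by simp
  qed
  have "0 \<le> (\<delta> \<bullet> (energy_matrix E B (exp_vec r) \<theta> *v \<delta>)) / 2"
    using assms by (simp add: energy_feasible_def pos_semidef_def)
  also have "\<dots> = (\<Sum>i\<in>UNIV. phase (\<chi> i. exp (r $ i) * (\<delta> $ i)\<^sup>2) (Some i) * (\<Sum>k\<in>nbrs E (Some i). B (Some i) k))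
      - (\<Sum>(i, k)\<in>E. edge_coeff (exp_vec r) \<theta> i k * (phase \<delta> i + phase \<delta> k)\<^sup>2 / 2)"
    unfolding inner_energy_matrix diff_divide_distrib sum_divide_distrib case_prod_unfold
    by (simp add: Bsum_def exp_vec_def power2_eq_square mult_ac)
  also have "(\<Sum>i\<in>UNIV. phase (\<chi> i. exp (r $ i) * (\<delta> $ i)\<^sup>2) (Some i) * (\<Sum>k\<in>nbrs E (Some i). B (Some i) k))
      = (\<Sum>(i, k)\<in>E. phase (\<chi> i. exp (r $ i) * (\<delta> $ i)\<^sup>2) i * B i k + phase (\<chi> i. exp (r $ i) * (\<delta> $ i)\<^sup>2) k * B k i)"
    by (rule sum_edges_by_bus[symmetric]) simp
  also have "\<dots> = (\<Sum>(i, k)\<in>E. B i k * ?L i k)"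
  proof -
    have "phase (\<chi> i. exp (r $ i) * (\<delta> $ i)\<^sup>2) b = exp (phase r b) * (phase \<delta> b)\<^sup>2" for b
      by (cases b) auto
    then show ?thesis by (intro sum.cong) (auto simp: edge_B algebra_simps)
  qed
  also have "\<dots> - (\<Sum>(i, k)\<in>E. edge_coeff (exp_vec r) \<theta> i k * (phase \<delta> i + phase \<delta> k)\<^sup>2 / 2)
      \<le> energy_deriv2 r \<theta> \<delta> \<eta>"
    unfolding energy_deriv2_def sum_subtractf[symmetric] case_prod_unfold
  proof (rule sum_mono, goal_cases)
    case (1 e)
    obtain i k where ik: "e = (i, k)" by (cases e)
    with 1 have e: "(i, k) \<in> E" by simp
    let ?u = "exp ((phase r i + phase r k) / 2)" and ?m = "phase \<delta> i + phase \<delta> k"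
      and ?c = "cos (phase \<theta> i - phase \<theta> k)" and ?s = "sin (phase \<theta> i - phase \<theta> k)"
      and ?n = "phase \<eta> i - phase \<eta> k"
    have "exp (phase r i) * exp (phase r k) = ?u * ?u"
      by (simp add: exp_add[symmetric])
    then have "edge_coeff (exp_vec r) \<theta> i k = B i k * (?u / ?c)"
      unfolding edge_coeff_def cos_term_def sqrt_volt_exp_vec
      by (simp add: volt_exp_vec mult.assoc)
    then have "edge_coeff (exp_vec r) \<theta> i k * ?m\<^sup>2 / 2 = B i k * (?u / 2 * (?m\<^sup>2 / ?c))"
      by simp
    moreover have "B i k * (?u * (?m\<^sup>2 / 2 * ?c - 2 * ?m * ?s * ?n - 2 * ?c * ?n\<^sup>2))
        \<le> B i k * (?u / 2 * (?m\<^sup>2 / ?c))"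
      by (intro mult_left_mono schur) (use energy_feasible_angle[OF assms e] edge_B(1)[OF e] in auto)
    moreover have "x * l - a \<le> x * (l - z)" if "x * z \<le> a" for x l z a :: real
      using that by (simp add: right_diff_distrib)
    ultimately show ?case
      unfolding ik fst_conv snd_conv by metis
  qed
  finally show ?thesis .
qed

text \<open>Along the segment to any competitor, which stays feasible, the derivative of the energy
  starts at 0 and is nondecreasing.\<close>

lemma stationary_imp_energy_optimal:
  assumes feas: "energy_feasible E B v \<theta>" and stat: "energy_stationary E B p q v \<theta>"
  shows "energy_optimal E B p q v \<theta>"
  unfolding energy_optimal_def
proof (intro conjI feas allI impI)
  fix u \<phi> assume feas': "energy_feasible E B u \<phi>"
  have pos: "positive v" "positive u" using feas feas' by (auto simp: energy_feasible_def)
  obtain r0 r1 where v: "v = exp_vec r0" and u: "u = exp_vec r1"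
    using positive_imp_exp_vec[OF pos(1)] positive_imp_exp_vec[OF pos(2)] by metis
  define d where "d t = energy_deriv p q (r0 + t *\<^sub>R (r1 - r0)) (\<theta> + t *\<^sub>R (\<phi> - \<theta>)) (r1 - r0) (\<phi> - \<theta>)" for t
  have "d 0 = 0"
    using stat unfolding energy_stationary_iff[OF pos(1)]
    by (simp add: d_def energy_deriv_by_bus v) (simp add: exp_vec_def)
  have d_nonneg: "0 \<le> d t" if "0 \<le> t" "t \<le> 1" for t
  proof -
    have "d 0 \<le> d t"
      unfolding d_def
      by (rule DERIV_nonneg_imp_nondecreasing[OF that(1)])
        (use that in \<open>blast intro: has_derivative_energy_deriv energy_deriv2_nonneg
          energy_feasible_segment[OF feas[unfolded v] feas'[unfolded u]] order_trans\<close>)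
    with \<open>d 0 = 0\<close> show ?thesis by simp
  qed
  have "energy E B p q (exp_vec (r0 + 0 *\<^sub>R (r1 - r0))) (\<theta> + 0 *\<^sub>R (\<phi> - \<theta>))
      \<le> energy E B p q (exp_vec (r0 + 1 *\<^sub>R (r1 - r0))) (\<theta> + 1 *\<^sub>R (\<phi> - \<theta>))"
    by (rule DERIV_nonneg_imp_nondecreasing[of 0 1 "\<lambda>t. energy E B p q
          (exp_vec (r0 + t *\<^sub>R (r1 - r0))) (\<theta> + t *\<^sub>R (\<phi> - \<theta>))", OF zero_le_one])
      (use has_derivative_energy d_nonneg in \<open>unfold d_def, blast\<close>)
  then show "energy E B p q v \<theta> \<le> energy E B p q u \<phi>"
    by (simp add: u v)
qed

end

text \<open>With \<open>m = dx y + x dy\<close>, the squared tangent exceeds the radicand by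
  \<open>m^2 / (4 c^2) - dx dy\<close>. This is nonnegative since \<open>c^2 \<le> x y\<close> and
  \<open>4 x y dx dy \<le> m^2\<close>. For \<open>dy = 0\<close> only the square of
  \<open>m\<close> remains.\<close>

lemma sqrt_tangent:
  fixes x y dx dy c s :: real
  assumes "0 < x" "0 < y" "0 \<le> dx" "0 \<le> dy" "0 < c" "c\<^sup>2 = x * y - s\<^sup>2"
  shows "sqrt ((x + dx) * (y + dy) - s\<^sup>2) \<le> c + (dx * y + x * dy) / (2 * c)"
    and "sqrt ((x + dx) * (y + dy) - s\<^sup>2) = c + (dx * y + x * dy) / (2 * c) \<Longrightarrow> dy = 0 \<Longrightarrow> dx = 0"
proof -
  define m where "m = dx * y + x * dy"
  have "0 \<le> m" using assms by (simp add: m_def)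
  have sq: "(c + m / (2 * c))\<^sup>2 = c\<^sup>2 + m + m\<^sup>2 / (4 * c\<^sup>2)"
    using assms(5) by (simp add: power2_eq_square field_simps)
  have "4 * c\<^sup>2 * (dx * dy) \<le> 4 * (x * y) * (dx * dy)"
    using assms by (intro mult_right_mono) auto
  also have "\<dots> \<le> m\<^sup>2"
    using zero_le_power2[of "dx * y - x * dy"] by (simp add: m_def power2_eq_square algebra_simps)
  finally have "dx * dy \<le> m\<^sup>2 / (4 * c\<^sup>2)"
    using assms(5) by (simp add: pos_le_divide_eq mult.commute)
  moreover have "(x + dx) * (y + dy) - s\<^sup>2 = c\<^sup>2 + m + dx * dy"
    using assms(6) by (simp add: m_def algebra_simps)
  ultimately have "(x + dx) * (y + dy) - s\<^sup>2 \<le> (c + m / (2 * c))\<^sup>2"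
    unfolding sq by linarith
  then show "sqrt ((x + dx) * (y + dy) - s\<^sup>2) \<le> c + (dx * y + x * dy) / (2 * c)"
    unfolding m_def[symmetric] using \<open>0 \<le> m\<close> assms(5) by (intro real_le_lsqrt) auto
  assume eq: "sqrt ((x + dx) * (y + dy) - s\<^sup>2) = c + (dx * y + x * dy) / (2 * c)" and "dy = 0"
  have "0 \<le> (x + dx) * (y + dy) - s\<^sup>2"
    using assms(1-4,6) \<open>dy = 0\<close> by (simp add: algebra_simps) (smt (verit) mult_nonneg_nonneg zero_le_power2)
  then have "(x + dx) * (y + dy) - s\<^sup>2 = (c + m / (2 * c))\<^sup>2"
    using eq by (metis m_def real_sqrt_pow2)
  moreover have "(x + dx) * (y + dy) - s\<^sup>2 = c\<^sup>2 + m"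
    using assms(6) \<open>dy = 0\<close> by (simp add: m_def algebra_simps)
  ultimately have "m\<^sup>2 / (4 * c\<^sup>2) = 0"
    unfolding sq by linarith
  then have "m = 0" using assms(5) by simp
  then show "dx = 0" using \<open>dy = 0\<close> assms(2) by (simp add: m_def)
qed

context radial_network begin

subsection \<open>Stationary points of the energy problem\<close>

lemma nbrs_iff_adj: "k \<in> nbrs E i \<longleftrightarrow> adj E i k"
  by (simp add: nbrs_def)

lemma energy_feasible_cos_term_pos:
  assumes "energy_feasible E B v \<theta>" "k \<in> nbrs E i"
  shows "0 < cos_term v \<theta> i k"
  using assms(2)
  by (cases rule: nbrs_cases) (use assms(1) cos_term_sym[of v \<theta> k i] in \<open>auto simp: energy_feasible_def\<close>)

lemma stationary_flow:
  assumes "positive v" "energy_stationary E B p q v \<theta>"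
  shows "on_edges E (sin_term v \<theta>) = flow E B p"
proof (rule flow_eqI)
  show "\<forall>i k. on_edges E (sin_term v \<theta>) k i = - on_edges E (sin_term v \<theta>) i k"
  proof (intro allI)
    show "on_edges E (sin_term v \<theta>) k i = - on_edges E (sin_term v \<theta>) i k" for i k
      using sin_term_antisym[of v \<theta> k i] adj_sym[of E k i] by (simp add: on_edges_def)
  qed
  have "(\<Sum>k\<in>nbrs E (Some i). B (Some i) k * on_edges E (sin_term v \<theta>) (Some i) k)
      = (\<Sum>k\<in>nbrs E (Some i). B (Some i) k * sin_term v \<theta> (Some i) k)" for i
    by (rule sum.cong) (auto simp: on_edges_def nbrs_def)
  then show "\<forall>i. (\<Sum>k\<in>nbrs E (Some i). B (Some i) k * on_edges E (sin_term v \<theta>) (Some i) k) = p $ i"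
    using assms(2) by (simp add: energy_stationary_iff[OF assms(1)])
qed (auto simp: on_edges_def)

lemma cos_term_sin_term_square:
  assumes "positive v"
  shows "(cos_term v \<theta> i k)\<^sup>2 = volt v i * volt v k - (sin_term v \<theta> i k)\<^sup>2"
proof -
  have "0 \<le> volt v i * volt v k"
    using volt_pos[OF assms] by (simp add: less_imp_le)
  then show ?thesis
    by (simp add: cos_term_def sin_term_def power_mult_distrib cos_squared_eq algebra_simps)
qed

lemma stationary_cos_term:
  assumes "energy_feasible E B v \<theta>" "energy_stationary E B p q v \<theta>" "k \<in> nbrs E i"
  shows "cos_term v \<theta> i k = root_term E B p v i k"
    and "(flow E B p i k)\<^sup>2 \<le> volt v i * volt v k"
proof -
  have "positive v" using assms(1) by (simp add: energy_feasible_def)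
  have "flow E B p i k = sin_term v \<theta> i k"
    using stationary_flow[OF \<open>positive v\<close> assms(2)] assms(3)
    by (metis nbrs_iff_adj on_edges_def)
  then have sq: "(cos_term v \<theta> i k)\<^sup>2 = volt v i * volt v k - (flow E B p i k)\<^sup>2"
    using cos_term_sin_term_square[OF \<open>positive v\<close>] by simp
  show "cos_term v \<theta> i k = root_term E B p v i k"
    unfolding root_term_def
    using real_sqrt_unique[OF sq] energy_feasible_cos_term_pos[OF assms(1,3)] by simp
  show "(flow E B p i k)\<^sup>2 \<le> volt v i * volt v k"
    using sq zero_le_power2[of "cos_term v \<theta> i k"] by linarith
qed

text \<open>Let \<open>z = (v' - v) / v\<close>.  By concavity of the square roots, the increment of the (equal)
  left-hand sides of the relaxation between \<open>v\<close> and \<open>v'\<close> is the linearization \<open>M z / 2\<close>, with \<open>M\<close>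
  the energy matrix, plus nonnegative gaps; as \<open>z\<^sup>T M z\<close> is nonnegative, the gaps vanish at all
  buses with \<open>z \<noteq> 0\<close>.  Strictness of the concavity then propagates \<open>z = 0\<close> from the root.\<close>

lemma stationary_eq_greatest_feasible:
  assumes feas: "energy_feasible E B v \<theta>" and stat: "energy_stationary E B p q v \<theta>"
    and greatest: "greatest_feasible p q v'"
  shows "v = v'"
proof -
  have v: "positive v" using feas by (simp add: energy_feasible_def)
  have v_neq: "v $ i \<noteq> 0" for i using v by (simp add: positive_def) (metis less_irrefl)
  let ?c = "root_term E B p v" and ?c' = "root_term E B p v'" and ?s = "flow E B p"
  note cos = stationary_cos_term[OF feas stat]
  have lhs: "relaxation_lhs E B p v i = q $ i" for i
    using stat unfolding energy_stationary_iff[OF v] relaxation_lhs_def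
    by (simp add: cos(1))
  have lhs': "relaxation_lhs E B p v' i = q $ i" for i
    unfolding relaxation_lhs_eq_iff greatest_feasible_fp_map[OF greatest] ..
  have "sqrt_defined E B p v"
    unfolding sqrt_defined_def using cos(2) edge_nbrs(1) by blast
  then have "relaxation_feasible E B p q v"
    using v lhs by (simp add: relaxation_feasible_def)
  \<comment> \<open>The order is essential: it gives \<open>z\<close> a sign, so that no terms of
    the pairing with the gaps can cancel.\<close>
  then have le: "v $ i \<le> v' $ i" for i
    using greatest by (simp add: greatest_feasible_def)
  define d where "d b = volt v' b - volt v b" for b
  have d_nonneg: "0 \<le> d b" for b using volt_mono[OF le] by (simp add: d_def)
  have volt': "volt v' b = volt v b + d b" for b by (simp add: d_def)
  define z where "z = (\<chi> i. d (Some i) / v $ i)"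
  have z: "phase z b = d b / volt v b" for b
    by (cases b) (auto simp: z_def d_def)
  \<comment> \<open>How far the root at \<open>v'\<close> falls below the tangent taken at
    \<open>v\<close>.\<close>
  define gap where "gap i k = ?c i k + (d i * volt v k + volt v i * d k) / (2 * ?c i k) - ?c' i k" for i k
  have c: "0 < ?c i k" "(?c i k)\<^sup>2 = volt v i * volt v k - (?s i k)\<^sup>2" if "k \<in> nbrs E i" for i k
    using energy_feasible_cos_term_pos[OF feas that] cos[OF that] by (auto simp: root_term_def)
  have gap_nonneg: "0 \<le> gap i k" if "k \<in> nbrs E i" for i k
    using sqrt_tangent(1)[OF volt_pos[OF v] volt_pos[OF v] d_nonneg d_nonneg c[OF that]]
    by (simp add: gap_def root_term_def[of _ _ _ v'] volt')
  have gap_zero: "d i = 0" if "k \<in> nbrs E i" "gap i k = 0" "d k = 0" for i k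
    using sqrt_tangent(2)[OF volt_pos[OF v] volt_pos[OF v] d_nonneg d_nonneg c[OF that(1)]] that(2,3)
    by (simp add: gap_def root_term_def[of _ _ _ v'] volt')
  have Mz: "(energy_matrix E B v \<theta> *v z) $ i = - 2 * (\<Sum>k\<in>nbrs E (Some i). B (Some i) k * gap (Some i) k)" for i
  proof -
    have halves: "n / a = 2 * (a + n / (2 * a) - b + b - a)" for n a b :: real
      by simp
    have edge: "edge_coeff v \<theta> (Some i) k * (z $ i + phase z k)
        = 2 * (B (Some i) k * gap (Some i) k) + 2 * (B (Some i) k * ?c' (Some i) k) - 2 * (B (Some i) k * ?c (Some i) k)"
      if "k \<in> nbrs E (Some i)" for k
    proof -
      have "volt v (Some i) * volt v k * (phase z (Some i) + phase z k)
          = d (Some i) * volt v k + volt v (Some i) * d k"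
        using volt_pos[OF v, of k] volt_pos[OF v, of "Some i"] unfolding z by (simp add: field_simps)
      then have "edge_coeff v \<theta> (Some i) k * (z $ i + phase z k)
          = B (Some i) k * ((d (Some i) * volt v k + volt v (Some i) * d k) / ?c (Some i) k)"
        by (simp add: edge_coeff_def cos(1)[OF that] mult.assoc)
      also have "(d (Some i) * volt v k + volt v (Some i) * d k) / ?c (Some i) k
          = 2 * (gap (Some i) k + ?c' (Some i) k - ?c (Some i) k)"
        unfolding gap_def by (rule halves)
      finally show ?thesis by (simp add: algebra_simps)
    qed
    have "v $ i * z $ i = v' $ i - v $ i"
      using v_neq[of i] by (simp add: z_def d_def)
    then have diag: "2 * Bsum E B (Some i) * v $ i * z $ i
        = 2 * (Bsum E B (Some i) * v' $ i) - 2 * (Bsum E B (Some i) * v $ i)"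
      by (simp add: mult.assoc right_diff_distrib)
    have sum: "(\<Sum>k\<in>nbrs E (Some i). edge_coeff v \<theta> (Some i) k * (z $ i + phase z k))
        = 2 * (\<Sum>k\<in>nbrs E (Some i). B (Some i) k * gap (Some i) k)
        + 2 * (\<Sum>k\<in>nbrs E (Some i). B (Some i) k * ?c' (Some i) k)
        - 2 * (\<Sum>k\<in>nbrs E (Some i). B (Some i) k * ?c (Some i) k)"
      unfolding sum_distrib_left sum.distrib[symmetric] sum_subtractf[symmetric]
      by (rule sum.cong[OF refl edge])
    have lin: "2 * x' - 2 * x - (2 * g + 2 * a' - 2 * a) = 2 * (x' - a' - (x - a)) - 2 * g"
      for x x' g a a' :: real by simp
    have "(energy_matrix E B v \<theta> *v z) $ i
        = 2 * (relaxation_lhs E B p v' i - relaxation_lhs E B p v i)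
        - 2 * (\<Sum>k\<in>nbrs E (Some i). B (Some i) k * gap (Some i) k)"
      unfolding energy_matrix_apply relaxation_lhs_def diag sum by (rule lin)
    then show ?thesis by (simp add: lhs lhs')
  qed
  have z_nonneg: "0 \<le> z $ i" for i
    using v d_nonneg by (simp add: z_def positive_def less_imp_le)
  define S where "S i = (\<Sum>k\<in>nbrs E (Some i). B (Some i) k * gap (Some i) k)" for i
  have B_gap_nonneg: "0 \<le> B i k * gap i k" if "k \<in> nbrs E i" for i k
    using gap_nonneg[OF that] B_pos[OF that] by simp
  then have S_nonneg: "0 \<le> S i" for i
    unfolding S_def by (rule sum_nonneg)
  have "0 \<le> z \<bullet> (energy_matrix E B v \<theta> *v z)"
    using feas by (simp add: energy_feasible_def pos_semidef_def)
  also have "\<dots> = - 2 * (\<Sum>i\<in>UNIV. z $ i * S i)"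
    by (simp add: inner_vec_def Mz S_def[symmetric] sum_distrib_left sum_negf mult.left_commute)
  finally have "(\<Sum>i\<in>UNIV. z $ i * S i) \<le> 0" by simp
  moreover have zS: "0 \<le> z $ i * S i" for i
    using z_nonneg S_nonneg by simp
  then have "0 \<le> (\<Sum>i\<in>UNIV. z $ i * S i)" by (simp add: sum_nonneg)
  ultimately have "(\<Sum>i\<in>UNIV. z $ i * S i) = 0" by simp
  then have zero: "z $ i * S i = 0" for i
    using sum_nonneg_eq_0_iff[of UNIV "\<lambda>i. z $ i * S i"] zS by simp
  have gap_vanishes: "gap (Some i) k = 0" if "z $ i \<noteq> 0" "k \<in> nbrs E (Some i)" for i k
  proof -
    have "S i = 0" using zero[of i] that(1) by simp
    then have "B (Some i) k * gap (Some i) k = 0"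
      using sum_nonneg_0[of "nbrs E (Some i)" "\<lambda>k. B (Some i) k * gap (Some i) k" k]
        B_gap_nonneg that(2) by (simp add: S_def)
    then show ?thesis using B_pos[OF that(2)] by simp
  qed
  have "d b = 0" for b
  proof (rule propagate_from_root[of "\<lambda>b. d b = 0"])
    fix i k assume e: "(i, k) \<in> E" and "d i = 0"
    show "d k = 0"
    proof (cases k)
      case (Some j)
      show ?thesis
      proof (rule ccontr)
        \<comment> \<open>A bus that moves has zero gap towards its parent; as the parent is fixed,
          strictness in \<open>sqrt_tangent\<close> forbids the move.\<close>
        assume "d k \<noteq> 0"
        then have "z $ j \<noteq> 0" using Some v_neq[of j] by (simp add: z_def)
        with gap_vanishes Some edge_nbrs(2)[OF e] have "gap k i = 0" by blast
        with gap_zero[OF edge_nbrs(2)[OF e]] \<open>d i = 0\<close> \<open>d k \<noteq> 0\<close> show False by blast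
      qed
    qed (simp add: d_def)
  qed (simp add: d_def)
  then show ?thesis
    using volt'[of "Some i" for i] by (simp add: vec_eq_iff)
qed

text \<open>On a tree the angle differences can be prescribed edge by edge. Choosing them by
  \<open>arcsin\<close> fixes the sine term and keeps the cosine nonnegative, so the cosine term is
  the nonnegative root.\<close>

lemma greatest_feasible_phase:
  assumes "greatest_feasible p q v"
  obtains \<theta> where "\<And>i k. k \<in> nbrs E i \<Longrightarrow> sin_term v \<theta> i k = flow E B p i k"
    "\<And>i k. k \<in> nbrs E i \<Longrightarrow> cos_term v \<theta> i k = root_term E B p v i k"
    "\<And>i k. (i, k) \<in> E \<Longrightarrow> \<bar>phase \<theta> i - phase \<theta> k\<bar> \<le> pi"
proof -
  have v: "positive v" "sqrt_defined E B p v"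
    using assms by (auto simp: greatest_feasible_def relaxation_feasible_def)
  define \<phi> where "\<phi> i k = arcsin (flow E B p i k / sqrt (volt v i * volt v k))" for i k
  obtain \<theta>' where \<theta>': "\<theta>' None = 0" "\<And>i k. (i, k) \<in> E \<Longrightarrow> \<theta>' i - \<theta>' k = \<phi> i k"
    using tree_potential[OF tree] by metis
  define \<theta> where "\<theta> = (\<chi> i. \<theta>' (Some i))"
  have phase: "phase \<theta> b = \<theta>' b" for b by (cases b) (auto simp: \<theta>_def \<theta>'(1))
  have edge: "sin_term v \<theta> i k = flow E B p i k \<and> cos_term v \<theta> i k = root_term E B p v i k
      \<and> \<bar>phase \<theta> i - phase \<theta> k\<bar> \<le> pi" if e: "(i, k) \<in> E" for i k
  proof -
    define a where "a = sqrt (volt v i * volt v k)"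
    have "0 < volt v i * volt v k" using volt_pos[OF v(1)] by simp
    then have a: "0 < a" "a\<^sup>2 = volt v i * volt v k" by (auto simp: a_def)
    have s: "(flow E B p i k)\<^sup>2 \<le> a\<^sup>2"
      using sqrt_definedD[OF v(2) edge_nbrs(1)[OF e]] a(2) by simp
    then have "\<bar>flow E B p i k\<bar> \<le> a" using a(1) by (simp add: abs_le_square_iff[symmetric])
    then have bounds: "-1 \<le> flow E B p i k / a" "flow E B p i k / a \<le> 1"
      using a(1) by (auto simp: field_simps)
    have angle: "phase \<theta> i - phase \<theta> k = arcsin (flow E B p i k / a)"
      by (simp add: phase \<theta>'(2)[OF e] \<phi>_def a_def)
    have "sin_term v \<theta> i k = flow E B p i k"
      unfolding sin_term_def angle a_def[symmetric] using bounds a(1) by simp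
    moreover have "cos_term v \<theta> i k = root_term E B p v i k"
    proof -
      have "cos_term v \<theta> i k = sqrt (a\<^sup>2) * sqrt (1 - (flow E B p i k / a)\<^sup>2)"
        unfolding cos_term_def angle a_def[symmetric] using bounds a(1) by (simp add: cos_arcsin)
      also have "\<dots> = root_term E B p v i k"
        unfolding root_term_def a(2)[symmetric] real_sqrt_mult[symmetric]
        using a(1) by (simp add: power_divide right_diff_distrib)
      finally show ?thesis .
    qed
    moreover have "\<bar>phase \<theta> i - phase \<theta> k\<bar> \<le> pi"
      unfolding angle using arcsin_bounded[OF bounds] pi_ge_zero by linarith
    ultimately show ?thesis by simp
  qed
  show ?thesis
  proof (rule that[of \<theta>])
    show "sin_term v \<theta> i k = flow E B p i k" "cos_term v \<theta> i k = root_term E B p v i k"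
      if "k \<in> nbrs E i" for i k
    proof -
      from that have "sin_term v \<theta> i k = flow E B p i k \<and> cos_term v \<theta> i k = root_term E B p v i k"
      proof (cases rule: nbrs_cases)
        case 2
        then show ?thesis
          using edge[OF 2] cos_term_sym[of v \<theta> k i] sin_term_antisym[of v \<theta> k i]
            root_term_sym[of p v k i] flow_antisym[of p k i] by simp
      qed (use edge in blast)
      then show "sin_term v \<theta> i k = flow E B p i k" "cos_term v \<theta> i k = root_term E B p v i k"
        by auto
    qed
    show "\<bar>phase \<theta> i - phase \<theta> k\<bar> \<le> pi" if "(i, k) \<in> E" for i k
      using edge[OF that] by simp
  qed
qed

lemma energy_computes_iff:
  assumes greatest: "greatest_feasible p q v"
  shows "energy_computes E B p q y \<longleftrightarrow> y = (v, flow E B p, on_edges E (root_term E B p v))"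
proof
  assume "energy_computes E B p q y"
  then obtain u s c \<theta> where y: "y = (u, s, c)" and opt: "energy_optimal E B p q u \<theta>"
    and stat: "energy_stationary E B p q u \<theta>"
    and s: "s = on_edges E (sin_term u \<theta>)" and c: "c = on_edges E (cos_term u \<theta>)"
    by (auto simp: energy_computes_def split: prod.splits)
  have feas: "energy_feasible E B u \<theta>" using opt by (simp add: energy_optimal_def)
  have "u = v" by (rule stationary_eq_greatest_feasible[OF feas stat greatest])
  moreover have "s = flow E B p"
    unfolding s using feas by (intro stationary_flow[OF _ stat]) (simp add: energy_feasible_def)
  moreover have "c = on_edges E (root_term E B p u)"
    unfolding c on_edges_def using stationary_cos_term(1)[OF feas stat]
    by (auto simp: fun_eq_iff nbrs_def)
  ultimately show "y = (v, flow E B p, on_edges E (root_term E B p v))"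
    by (simp add: y)
next
  assume y: "y = (v, flow E B p, on_edges E (root_term E B p v))"
  have v: "positive v" using greatest by (auto simp: greatest_feasible_def relaxation_feasible_def)
  obtain \<theta> where sin: "\<And>i k. k \<in> nbrs E i \<Longrightarrow> sin_term v \<theta> i k = flow E B p i k"
    and cos: "\<And>i k. k \<in> nbrs E i \<Longrightarrow> cos_term v \<theta> i k = root_term E B p v i k"
    and angle: "\<And>i k. (i, k) \<in> E \<Longrightarrow> \<bar>phase \<theta> i - phase \<theta> k\<bar> \<le> pi"
    using greatest_feasible_phase[OF greatest] by metis
  have "0 < cos_term v \<theta> i k" if "(i, k) \<in> E" for i k
    using cos[OF edge_nbrs(1)[OF that]] greatest_feasible_root_term_pos[OF greatest edge_nbrs(1)[OF that]]
    by simp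
  then have feas: "energy_feasible E B v \<theta>"
    unfolding energy_feasible_def
    using v angle greatest_feasible_pos_semidef[OF greatest cos] by blast
  have "relaxation_lhs E B p v i = q $ i" for i
    unfolding relaxation_lhs_eq_iff greatest_feasible_fp_map[OF greatest] ..
  then have stat: "energy_stationary E B p q v \<theta>"
    unfolding energy_stationary_iff[OF v] relaxation_lhs_def
    by (simp add: sin cos flow_balance)
  have "on_edges E (root_term E B p v) = on_edges E (cos_term v \<theta>)"
    unfolding on_edges_def using cos by (auto simp: fun_eq_iff nbrs_def)
  then show "energy_computes E B p q y"
    using stationary_imp_energy_optimal[OF feas stat] stat stationary_flow[OF v stat]
    by (auto simp: energy_computes_def y)
qed

section \<open>Solvability versus success\<close>

lemma relaxation_succeeds_imp_solvable:
  assumes "relaxation_succeeds E B p q w"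
  shows "\<exists>x. power_flow_solution E B p q x"
proof -
  obtain v s c where "relaxation_computes E B p q w (v, s, c)"
    using assms by (auto simp: relaxation_succeeds_def)
  then have "positive v" "sqrt_defined E B p v" "\<And>i. relaxation_lhs E B p v i = q $ i"
    by (auto simp: relaxation_computes_def relaxation_optimal_def relaxation_feasible_def)
  then show ?thesis using tight_imp_power_flow_solution by blast
qed

text \<open>The given solution only provides feasibility; the greatest feasible point is a fixed
  point of \<open>g\<close>, hence tight, and yields a solution with nonnegative
  \<open>c\<close>.\<close>

lemma solvable_imp_greatest_feasible:
  assumes "power_flow_solution E B p q x"
  obtains v where "greatest_feasible p q v"
    "power_flow_solution E B p q (v, flow E B p, on_edges E (root_term E B p v))"
proof -
  have "relaxation_feasible E B p q (fst x)"
    using assms power_flow_solution_imp_feasible[of p q "fst x" "fst (snd x)" "snd (snd x)"] by simp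
  then obtain v where v: "greatest_feasible p q v"
    using greatest_feasible_exists by metis
  moreover have "relaxation_lhs E B p v i = q $ i" for i
    unfolding relaxation_lhs_eq_iff greatest_feasible_fp_map[OF v] ..
  ultimately show ?thesis
    by (intro that[of v] tight_imp_power_flow_solution)
      (auto simp: greatest_feasible_def relaxation_feasible_def)
qed

end

theorem mainTheorem1:
  fixes E :: "'n::finite edges"
    and B :: "'n option \<Rightarrow> 'n option \<Rightarrow> real"
    and p q w :: "real ^ 'n"
  assumes tree: "is_tree E" "oriented_away_from None E"
    and weights: "edge_weights E B"
    and w_pos: "\<forall>i. 0 < w $ i"
  defines "solvable \<equiv> (\<exists>x. power_flow_solution E B p q x)"
    and "all_succeed \<equiv>
      relaxation_succeeds E B p q w \<and> energy_succeeds E B p q \<and> fixed_point_succeeds E B p q"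
  shows "(solvable \<longleftrightarrow> all_succeed) \<and>
    (solvable \<or> all_succeed \<longrightarrow>
      (\<exists>x. power_flow_solution E B p q x \<and>
        (\<forall>y. relaxation_computes E B p q w y \<longleftrightarrow> y = x) \<and>
        (\<forall>y. energy_computes E B p q y \<longleftrightarrow> y = x) \<and>
        (\<forall>y. fixed_point_computes E B p q y \<longleftrightarrow> y = x)))"
proof -
  interpret radial_network E B
    by unfold_locales (fact tree weights)+
  have common: "\<exists>x. power_flow_solution E B p q x \<and>
        (\<forall>y. relaxation_computes E B p q w y \<longleftrightarrow> y = x) \<and>
        (\<forall>y. energy_computes E B p q y \<longleftrightarrow> y = x) \<and>
        (\<forall>y. fixed_point_computes E B p q y \<longleftrightarrow> y = x)" if solvable
  proof -
    obtain x where "power_flow_solution E B p q x"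
      using \<open>solvable\<close> by (auto simp: solvable_def)
    then obtain v where v: "greatest_feasible p q v"
      "power_flow_solution E B p q (v, flow E B p, on_edges E (root_term E B p v))"
      by (rule solvable_imp_greatest_feasible)
    then show ?thesis
      using relaxation_computes_iff[OF v(1) w_pos] energy_computes_iff[OF v(1)]
        fixed_point_computes_iff[OF v(1)] by blast
  qed
  moreover have all_succeed if solvable
    using common[OF that]
    unfolding all_succeed_def relaxation_succeeds_def energy_succeeds_def fixed_point_succeeds_def
    by blast
  \<comment> \<open>A tight optimum of the relaxation is already a power flow solution.\<close>
  moreover have solvable if all_succeed
    using that relaxation_succeeds_imp_solvable unfolding all_succeed_def solvable_def by blast
  ultimately show ?thesis by blast
qed

end
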